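(* Let $k\ge2$, let $Z$ be a random vector in $\mathbb{R}^k$ with mutually independent components, $\mathbb{E}[Z_j]=0$ and $\sigma_j^2:=\mathbb{E}[Z_j^2]\in(0,\infty)$ for all $j$. Let $\eta_1,\dots,\eta_k:\mathbb{R}\to\mathbb{R}$ be arbitrary twice continuously differentiable functions, and assume $$\sup_{u\in\mathbb{R}}|\eta_j''(u)|<\infty\ \text{ for all } j,\qquad \mathbb{E}\bigl[\|Z\|^3\bigr]<\infty .$$ Assume finally the normalisation $\mathbb{E}[\eta_j(Z_j)Z_j]=-1$ for $j=1,\dots,k$. For a step size $\alpha>0$ consider the update on $k\times k$ real matrices $$R\ \leftarrow\ \Bigl(I_k+\alpha\bigl(I_k+\mathbb{E}[\eta(RZ)(RZ)^{\mathsf T}]\bigr)\Bigr)R. \qquad (\ast)$$ Then $R=I_k$ is a stationary point of $(\ast)$. Define $$\beta_j:=\mathbb{E}[\eta_j'(Z_j)],\qquad \gamma_j:=\mathbb{E}[\eta_j'(Z_j)Z_j^2],\qquad \zeta_j:=-\beta_j\sigma_j^2 .$$ Writing $R=I_k+\varepsilon$, the update $(\ast)$ linearised at $\varepsilon=0$ decouples into the $k$ scalar recursions $$\varepsilon_{jj}\longmapsto\bigl(1+\alpha(\gamma_j-1)\bigr)\varepsilon_{jj}$$ and the $\binom k2$ two-dimensional recursions $$\begin{bmatrix}\varepsilon_{jl}\\ \varepsilon_{lj}\end{bmatrix}\longmapsto(I_2+\alpha M_{jl})\begin{bmatrix}\varepsilon_{jl}\\ \varepsilon_{lj}\end{bmatrix},\qquad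 M_{jl}:=\begin{bmatrix}\beta_j\sigma_l^2&-1\\-1&\beta_l\sigma_j^2\end{bmatrix},\qquad j\ne l .$$ Consequently the conditions $$\gamma_j<1\ \text{ for all } j,\qquad \zeta_j>0\ \text{ for all } j,\qquad \zeta_j\zeta_l>1\ \text{ for all } j\neq l$$ are sufficient for $R=I_k$ to be locally asymptotically stable (for the iteration $(\ast)$) for all sufficiently small step sizes $\alpha>0$; if any one of these inequalities is reversed strictly, then $R=I_k$ is unstable for every $\alpha>0$.
   Context: For $c\in\mathbb{R}^k$, $\eta(c):=[\eta_1(c_1),\dots,\eta_k(c_k)]^{\mathsf T}$ is applied componentwise; $I_k$ is the $k\times k$ identity matrix. Stationary point of the update means a matrix $R$ at which $I_k+\mathbb{E}[\eta(RZ)(RZ)^{\mathsf T}]=0$ (hence a fixed point of $(\ast)$). Stability is meant in the usual sense of discrete dynamical systems (Lyapunov stability, respectively asymptotic stability, of the fixed point under iteration of the map). *)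

theory Defs
  imports "HOL-Probability.Probability"
begin

definition twice_cont_differentiable :: "(real \<Rightarrow> real) \<Rightarrow> bool" where
  "twice_cont_differentiable f \<longleftrightarrow>
     f differentiable_on UNIV \<and> deriv f differentiable_on UNIV \<and>
     continuous_on UNIV (deriv (deriv f))"

definition outer_prod :: "real ^ 'm \<Rightarrow> real ^ 'n \<Rightarrow> real ^ 'n ^ 'm" where
  "outer_prod v w = (\<chi> i j. v $ i * w $ j)"

definition apply_componentwise :: "('k \<Rightarrow> real \<Rightarrow> real) \<Rightarrow> real ^ 'k \<Rightarrow> real ^ 'k" where
  "apply_componentwise \<eta> c = (\<chi> j. \<eta> j (c $ j))"

text \<open>
  The expectation is the Bochner integral of a matrix-valued random variable. In all
  definitions below, an expectation that does not exist would be read as 0; bounded second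
  derivatives of \<open>\<eta>\<close> and a finite third moment of \<open>Z\<close> make every one of them exist.
\<close>

definition score_matrix ::
    "'a measure \<Rightarrow> ('k::finite \<Rightarrow> real \<Rightarrow> real) \<Rightarrow> ('a \<Rightarrow> real ^ 'k) \<Rightarrow> real ^ 'k ^ 'k \<Rightarrow> real ^ 'k ^ 'k" where
  "score_matrix M \<eta> Z R =
     mat 1 + (\<integral>\<omega>. outer_prod (apply_componentwise \<eta> (R *v Z \<omega>)) (R *v Z \<omega>) \<partial>M)"

definition stationary_point ::
    "'a measure \<Rightarrow> ('k::finite \<Rightarrow> real \<Rightarrow> real) \<Rightarrow> ('a \<Rightarrow> real ^ 'k) \<Rightarrow> real ^ 'k ^ 'k \<Rightarrow> bool" where
  "stationary_point M \<eta> Z R \<longleftrightarrow> score_matrix M \<eta> Z R = 0"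

definition update ::
    "'a measure \<Rightarrow> ('k::finite \<Rightarrow> real \<Rightarrow> real) \<Rightarrow> ('a \<Rightarrow> real ^ 'k) \<Rightarrow> real \<Rightarrow> real ^ 'k ^ 'k \<Rightarrow> real ^ 'k ^ 'k" where
  "update M \<eta> Z \<alpha> R = (mat 1 + \<alpha> *\<^sub>R score_matrix M \<eta> Z R) ** R"

definition sigma_sq :: "'a measure \<Rightarrow> ('a \<Rightarrow> real ^ 'k) \<Rightarrow> 'k \<Rightarrow> real" where
  "sigma_sq M Z j = (\<integral>\<omega>. (Z \<omega> $ j)\<^sup>2 \<partial>M)"

definition beta :: "'a measure \<Rightarrow> ('k \<Rightarrow> real \<Rightarrow> real) \<Rightarrow> ('a \<Rightarrow> real ^ 'k) \<Rightarrow> 'k \<Rightarrow> real" where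
  "beta M \<eta> Z j = (\<integral>\<omega>. deriv (\<eta> j) (Z \<omega> $ j) \<partial>M)"

definition gamma :: "'a measure \<Rightarrow> ('k \<Rightarrow> real \<Rightarrow> real) \<Rightarrow> ('a \<Rightarrow> real ^ 'k) \<Rightarrow> 'k \<Rightarrow> real" where
  "gamma M \<eta> Z j = (\<integral>\<omega>. deriv (\<eta> j) (Z \<omega> $ j) * (Z \<omega> $ j)\<^sup>2 \<partial>M)"

definition zeta :: "'a measure \<Rightarrow> ('k \<Rightarrow> real \<Rightarrow> real) \<Rightarrow> ('a \<Rightarrow> real ^ 'k) \<Rightarrow> 'k \<Rightarrow> real" where
  "zeta M \<eta> Z j = - beta M \<eta> Z j * sigma_sq M Z j"

definition block ::
    "'a measure \<Rightarrow> ('k \<Rightarrow> real \<Rightarrow> real) \<Rightarrow> ('a \<Rightarrow> real ^ 'k) \<Rightarrow> 'k \<Rightarrow> 'k \<Rightarrow> real ^ 2 ^ 2" where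
  "block M \<eta> Z j l =
     vector [vector [beta M \<eta> Z j * sigma_sq M Z l, -1],
             vector [-1, beta M \<eta> Z l * sigma_sq M Z j]]"

text \<open>Stability of a fixed point \<open>p\<close> under iteration of \<open>f\<close>. The two positive notions
  force \<open>f p = p\<close>; instability has to require it explicitly.\<close>

definition lyapunov_stable :: "('a::metric_space \<Rightarrow> 'a) \<Rightarrow> 'a \<Rightarrow> bool" where
  "lyapunov_stable f p \<longleftrightarrow>
     (\<forall>e>0. \<exists>d>0. \<forall>x. dist x p < d \<longrightarrow> (\<forall>n. dist ((f ^^ n) x) p < e))"

definition locally_asymptotically_stable :: "('a::metric_space \<Rightarrow> 'a) \<Rightarrow> 'a \<Rightarrow> bool" where
  "locally_asymptotically_stable f p \<longleftrightarrow>
     lyapunov_stable f p \<and>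
     (\<exists>d>0. \<forall>x. dist x p < d \<longrightarrow> (\<lambda>n. (f ^^ n) x) \<longlonglongrightarrow> p)"

definition unstable :: "('a::metric_space \<Rightarrow> 'a) \<Rightarrow> 'a \<Rightarrow> bool" where
  "unstable f p \<longleftrightarrow> f p = p \<and> \<not> lyapunov_stable f p"

end

theory Submission
  imports Defs
begin

text \<open>
  Write \<open>A\<close> for the derivative of the score matrix at the identity. Since the score vanishes there, the
  update linearises to \<open>L = I + \<alpha> A\<close>, and everything follows from one structural fact: \<open>A\<close> is
  self-adjoint for the Frobenius inner product, because it scales the diagonal entries and acts on
  each pair \<open>(\<epsilon>\<^sub>j\<^sub>l, \<epsilon>\<^sub>l\<^sub>j)\<close> by the symmetric matrix \<open>M\<^sub>j\<^sub>l\<close>. The stability question thus becomes one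
  about the sign of the quadratic form \<open>\<epsilon> \<mapsto> A \<epsilon> \<bullet> \<epsilon>\<close>.

  Computing \<open>A\<close> is a matter of moments. Bounded second derivatives of the \<open>\<eta>\<^sub>j\<close> make the integrand
  of the score differ from its first-order expansion, for \<open>\<parallel>\<epsilon>\<parallel> \<le> 1\<close>, by at most \<open>\<parallel>\<epsilon>\<parallel>\<^sup>2\<close> times a
  cubic polynomial in \<open>\<parallel>Z\<parallel>\<close>, whose expectation is finite (\<open>score_matrix_has_derivative\<close>); in
  the expectation of the linear part, independence and centring leave only the terms with \<open>\<beta>\<close>, \<open>\<gamma>\<close>, \<open>\<sigma>\<^sup>2\<close> and the
  normalisation (\<open>expectation_linear_part\<close>).

  If the three families of inequalities hold, the factors \<open>\<gamma>\<^sub>j - 1\<close> of the diagonal entries are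
  negative, and each \<open>M\<^sub>j\<^sub>l\<close> has negative diagonal entries and determinant
  \<open>\<zeta>\<^sub>j \<zeta>\<^sub>l - 1 > 0\<close>, so the form is negative definite (\<open>score_deriv_negative\<close>). Then \<open>L\<close> is a strict
  contraction for small \<open>\<alpha>\<close> (\<open>small_step_contraction\<close>), and the nonlinear map contracts near its
  fixed point.

  If one inequality is reversed, some \<open>v\<close> has \<open>A v \<bullet> v > 0\<close> (\<open>score_deriv_positive\<close>), so
  \<open>\<parallel>L v\<parallel> > \<parallel>v\<parallel>\<close> for every \<open>\<alpha> > 0\<close>. For a self-adjoint \<open>L\<close> this already forces instability
  (\<open>unstable_if_linearization_expands\<close>): the function \<open>W h = \<parallel>L h\<parallel>\<^sup>2 - c \<parallel>h\<parallel>\<^sup>2\<close>, with \<open>c\<close>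
  between 1 and the square of the expansion factor \<open>\<parallel>L v\<parallel> / \<parallel>v\<parallel>\<close>, satisfies
  \<open>W (L h) = c W h + \<parallel>(L\<^sup>2 - c) h\<parallel>\<^sup>2\<close>. If \<open>c\<close> is not an eigenvalue of \<open>L\<^sup>2\<close>, the last square
  absorbs the nonlinear remainder, and \<open>W\<close> grows geometrically along orbits.
\<close>

section \<open>Stability of a fixed point by linearisation\<close>

text \<open>
  Eigenvectors of a self-adjoint map for distinct eigenvalues are orthogonal, hence linearly
  independent, so there are at most as many eigenvalues as dimensions. This leaves room to choose
  the constant \<open>c\<close> in the next proof off the spectrum.
\<close>

lemma selfadjoint_finite_eigenvalues:
  fixes T :: "'v::euclidean_space \<Rightarrow> 'v"
  assumes selfadj: "\<And>x y. T x \<bullet> y = x \<bullet> T y"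
  shows "finite {c. \<exists>x. x \<noteq> 0 \<and> T x = c *\<^sub>R x}"
proof -
  define E where "E = {c. \<exists>x. x \<noteq> 0 \<and> T x = c *\<^sub>R x}"
  have "\<forall>c\<in>E. \<exists>x. x \<noteq> 0 \<and> T x = c *\<^sub>R x" by (auto simp: E_def)
  then obtain e where e: "\<And>c. c \<in> E \<Longrightarrow> e c \<noteq> 0 \<and> T (e c) = c *\<^sub>R e c" by metis
  have orth: "e c \<bullet> e d = 0" if "c \<in> E" "d \<in> E" "c \<noteq> d" for c d
  proof -
    have "c * (e c \<bullet> e d) = d * (e c \<bullet> e d)"
      using selfadj[of "e c" "e d"] e that by simp
    thus ?thesis using that by simp
  qed
  have inj: "inj_on e E"
  proof (rule inj_onI, rule ccontr)
    fix c d assume "c \<in> E" "d \<in> E" "e c = e d" "c \<noteq> d"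
    thus False using orth[of c d] e[of d] by simp
  qed
  have "pairwise orthogonal (e ` E)"
    unfolding pairwise_def orthogonal_def using orth by blast
  moreover have "0 \<notin> e ` E" using e by force
  ultimately have "finite (e ` E)"
    using pairwise_orthogonal_independent independent_imp_finite by blast
  with inj have "finite E" using finite_imageD by blast
  thus ?thesis by (simp add: E_def)
qed

text \<open>
  A Chetaev-type argument. The function \<open>W\<close> below is positive at \<open>v\<close>, bounded on bounded sets, and
  multiplied by at least \<open>c > 1\<close> in every step that starts near the fixed point, so that no orbit
  starting in the direction of \<open>v\<close> can stay near \<open>p\<close>.
\<close>

lemma unstable_if_linearization_expands:
  fixes f L :: "'v::euclidean_space \<Rightarrow> 'v"
  assumes fp: "f p = p"
    and deriv: "(f has_derivative L) (at p)"
    and selfadj: "\<And>x y. L x \<bullet> y = x \<bullet> L y"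
    and expand: "norm v < norm (L v)"
  shows "unstable f p"
proof -
  have bl: "bounded_linear L" using deriv by (rule has_derivative_bounded_linear)
  then interpret L: bounded_linear L .
  have v0: "v \<noteq> 0" using expand by (auto simp: L.zero)
  define r where "r = (norm (L v) / norm v)\<^sup>2"
  have "1 < norm (L v) / norm v" using expand v0 by simp
  then have r1: "1 < r" unfolding r_def by (rule one_less_power) simp
  \<comment> \<open>All but finitely many \<open>c\<close> are admissible, because \<open>L \<circ> L\<close> has finitely many eigenvalues.\<close>
  have "finite {c. \<exists>x. x \<noteq> 0 \<and> L (L x) = c *\<^sub>R x}"
    by (rule selfadjoint_finite_eigenvalues[of "\<lambda>x. L (L x)"]) (simp add: selfadj)
  moreover have "infinite {1<..<r}" using r1 by (simp add: infinite_Ioo)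
  ultimately have "\<not> {1<..<r} \<subseteq> {c. \<exists>x. x \<noteq> 0 \<and> L (L x) = c *\<^sub>R x}"
    using finite_subset by blast
  then obtain c where "c \<in> {1<..<r}" and c': "c \<notin> {c. \<exists>x. x \<noteq> 0 \<and> L (L x) = c *\<^sub>R x}"
    by (meson subsetI)
  then have c1: "1 < c" and cr: "c < r" by auto
  have c: "x = 0" if "L (L x) = c *\<^sub>R x" for x using c' that by blast
  have lin: "linear (\<lambda>x. L (L x) - c *\<^sub>R x)"
    by (rule linearI) (simp_all add: L.add L.scaleR algebra_simps)
  moreover have "inj (\<lambda>x. L (L x) - c *\<^sub>R x)"
    unfolding linear_injective_0[OF lin] using c by simp
  ultimately obtain B where B: "B > 0" "\<And>x. B * norm x \<le> norm (L (L x) - c *\<^sub>R x)"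
    using linear_inj_bounded_below_pos by blast
  obtain K where K: "K > 0" "\<And>x. norm (L x) \<le> K * norm x"
    using L.pos_bounded by (auto simp: mult.commute)
  define W where "W y = (norm (L y))\<^sup>2 - c * (norm y)\<^sup>2" for y
  have W_L: "W (L h) = c * W h + (norm (L (L h) - c *\<^sub>R h))\<^sup>2" for h
  proof -
    have "L (L h) \<bullet> h = L h \<bullet> L h" by (simp add: selfadj)
    thus ?thesis unfolding W_def power2_norm_eq_inner
      by (simp add: inner_diff_left inner_diff_right inner_commute algebra_simps)
  qed
  define D where "D = 2 * K^3 + 2 * c * K + c"
  have D: "D > 0" using K c1 by (simp add: D_def add_pos_pos)
  \<comment> \<open>The tolerance \<open>\<delta>\<close> is chosen so that the error \<open>\<delta> D \<parallel>h\<parallel>\<^sup>2\<close> which the remainder causes in \<open>W\<close> is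
     at most the gain \<open>B\<^sup>2 \<parallel>h\<parallel>\<^sup>2\<close> of the exact linear step.\<close>
  define \<delta> where "\<delta> = min 1 (B\<^sup>2 / D)"
  have \<delta>: "\<delta> > 0" "\<delta> \<le> 1" "\<delta> * D \<le> B\<^sup>2"
    using B D by (auto simp: \<delta>_def min_def field_simps)
  obtain d where d: "d > 0"
    and rem: "\<And>x. norm (x - p) < d \<Longrightarrow> norm (f x - f p - L (x - p)) \<le> \<delta> * norm (x - p)"
    using deriv \<delta>(1) unfolding has_derivative_at_alt by blast
  have step: "c * W (x - p) \<le> W (f x - p)" if "norm (x - p) < d" for x
  proof -
    define h where "h = x - p"
    define a where "a = L h"
    define q where "q = f x - p - a"
    have q: "norm q \<le> \<delta> * norm h" using rem[OF that] fp by (simp add: q_def a_def h_def)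
    have a: "norm a \<le> K * norm h" using K by (simp add: a_def)
    have fx: "f x - p = a + q" by (simp add: q_def)
    have i1: "\<bar>L a \<bullet> L q\<bar> \<le> (K * (K * norm h)) * (K * (\<delta> * norm h))"
      by (rule order_trans[OF Cauchy_Schwarz_ineq2], intro mult_mono order_trans[OF K(2)]
          mult_left_mono a q) (use K in auto)
    have i2: "\<bar>a \<bullet> q\<bar> \<le> (K * norm h) * (\<delta> * norm h)"
      by (rule order_trans[OF Cauchy_Schwarz_ineq2], intro mult_mono a q) (use K in auto)
    have i3: "(norm q)\<^sup>2 \<le> \<delta> * (norm h)\<^sup>2"
    proof -
      have "(norm q)\<^sup>2 \<le> (\<delta> * norm h)\<^sup>2" using q by (intro power_mono) auto
      also have "\<dots> = \<delta> * (\<delta> * (norm h)\<^sup>2)" by (simp add: power2_eq_square)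
      also have "\<dots> \<le> 1 * (\<delta> * (norm h)\<^sup>2)" using \<delta> by (intro mult_right_mono) auto
      finally show ?thesis by simp
    qed
    have "W (a + q) = W a + (2 * (L a \<bullet> L q) + (norm (L q))\<^sup>2 - 2 * c * (a \<bullet> q) - c * (norm q)\<^sup>2)"
      unfolding W_def power2_norm_eq_inner
      by (simp add: L.add inner_add_left inner_add_right inner_commute algebra_simps)
    moreover have "2 * (L a \<bullet> L q) \<ge> - (2 * ((K * (K * norm h)) * (K * (\<delta> * norm h))))"
      using i1 by linarith
    moreover have "2 * c * (a \<bullet> q) \<le> 2 * c * ((K * norm h) * (\<delta> * norm h))"
      using i2 c1 by (intro mult_left_mono) auto
    moreover have "c * (norm q)\<^sup>2 \<le> c * (\<delta> * (norm h)\<^sup>2)"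
      using i3 c1 by (intro mult_left_mono) auto
    moreover have "2 * ((K * (K * norm h)) * (K * (\<delta> * norm h))) + 2 * c * ((K * norm h) * (\<delta> * norm h))
        + c * (\<delta> * (norm h)\<^sup>2) = (\<delta> * D) * (norm h)\<^sup>2"
      by (simp add: D_def power2_eq_square power3_eq_cube algebra_simps)
    ultimately have "W (a + q) \<ge> W a - (\<delta> * D) * (norm h)\<^sup>2"
      using zero_le_power2[of "norm (L q)"] by linarith
    moreover have "(\<delta> * D) * (norm h)\<^sup>2 \<le> B\<^sup>2 * (norm h)\<^sup>2"
      using \<delta> by (intro mult_right_mono) auto
    moreover have "B\<^sup>2 * (norm h)\<^sup>2 \<le> (norm (L (L h) - c *\<^sub>R h))\<^sup>2"
      using power_mono[OF B(2)[of h], of 2] B(1) by (simp add: power_mult_distrib)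
    ultimately show ?thesis using W_L[of h] by (simp add: fx a_def h_def)
  qed
  have "\<not> lyapunov_stable f p"
  proof
    assume "lyapunov_stable f p"
    with d obtain d' where d': "d' > 0"
      and stay: "\<And>x n. dist x p < d' \<Longrightarrow> dist ((f ^^ n) x) p < d"
      unfolding lyapunov_stable_def by blast
    define s where "s = d' / (2 * norm v)"
    define x where "x = p + s *\<^sub>R v"
    have s: "s > 0" using d' v0 by (simp add: s_def)
    have near: "norm ((f ^^ n) x - p) < d" for n
      using stay[of x n] d' v0 by (simp add: x_def s_def dist_norm)
    have grow: "c ^ n * W (x - p) \<le> W ((f ^^ n) x - p)" for n
    proof (induction n)
      case (Suc n)
      have "c ^ Suc n * W (x - p) \<le> c * W ((f ^^ n) x - p)" using Suc c1 by simp
      also have "\<dots> \<le> W ((f ^^ Suc n) x - p)" using step[OF near[of n]] by simp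
      finally show ?case .
    qed simp
    have "c * (norm v)\<^sup>2 < (norm (L v))\<^sup>2"
      using cr v0 by (simp add: r_def power_divide field_simps)
    moreover have "W (x - p) = s\<^sup>2 * ((norm (L v))\<^sup>2 - c * (norm v)\<^sup>2)"
      by (simp add: x_def W_def L.scaleR power_mult_distrib algebra_simps)
    ultimately have Wpos: "W (x - p) > 0" using s by simp
    obtain n where n: "K\<^sup>2 * d\<^sup>2 / W (x - p) < c ^ n" using real_arch_pow[OF c1] by blast
    define y where "y = (f ^^ n) x - p"
    have "W y \<le> (norm (L y))\<^sup>2" using c1 by (simp add: W_def)
    also have "\<dots> \<le> (K * d)\<^sup>2"
      using K(2)[of y] near[of n] K(1)
      by (intro power_mono) (auto simp: y_def intro: order_trans mult_left_mono)
    finally have "W y \<le> K\<^sup>2 * d\<^sup>2" by (simp add: power_mult_distrib)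
    moreover have "K\<^sup>2 * d\<^sup>2 < c ^ n * W (x - p)" using n Wpos by (simp add: field_simps)
    ultimately show False using grow[of n] by (simp add: y_def)
  qed
  with fp show ?thesis by (simp add: unstable_def)
qed

text \<open>
  Near the fixed point the remainder costs at most the factor \<open>r - q\<close>, so that the nonlinear map
  still shrinks distances to \<open>p\<close> by the factor \<open>r < 1\<close>.
\<close>

lemma stable_if_linearization_contracts:
  fixes f L :: "'v::real_normed_vector \<Rightarrow> 'v"
  assumes fp: "f p = p"
    and deriv: "(f has_derivative L) (at p)"
    and q: "0 \<le> q" "q < 1" and contract: "\<And>x. norm (L x) \<le> q * norm x"
  shows "locally_asymptotically_stable f p"
proof -
  define r where "r = (1 + q) / 2"
  have r: "0 \<le> r" "r < 1" "r - q > 0" using q by (auto simp: r_def field_simps)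
  obtain d where d: "d > 0"
    and rem: "\<And>x. norm (x - p) < d \<Longrightarrow> norm (f x - f p - L (x - p)) \<le> (r - q) * norm (x - p)"
    using deriv r(3) unfolding has_derivative_at_alt by blast
  have step: "dist (f x) p \<le> r * dist x p" if "dist x p < d" for x
  proof -
    have "norm (f x - p) \<le> norm (f x - f p - L (x - p)) + norm (L (x - p))"
      using norm_triangle_ineq[of "f x - f p - L (x - p)" "L (x - p)"] fp by simp
    also have "\<dots> \<le> (r - q) * norm (x - p) + q * norm (x - p)"
      using rem[of x] contract that by (intro add_mono) (auto simp: dist_norm)
    finally show ?thesis by (simp add: dist_norm algebra_simps)
  qed
  have iter: "dist ((f ^^ n) x) p \<le> r ^ n * dist x p" if x: "dist x p < d" for x n
  proof (induction n)
    case (Suc n)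
    have "r ^ n * dist x p \<le> 1 * dist x p" using r by (intro mult_right_mono power_le_one) auto
    hence "dist ((f ^^ n) x) p < d" using Suc x by simp
    hence "dist ((f ^^ Suc n) x) p \<le> r * dist ((f ^^ n) x) p" using step by simp
    also have "\<dots> \<le> r * (r ^ n * dist x p)" using Suc r by (intro mult_left_mono) auto
    finally show ?case by simp
  qed simp
  have "lyapunov_stable f p"
    unfolding lyapunov_stable_def
  proof (intro allI impI)
    fix e :: real assume e: "e > 0"
    show "\<exists>d>0. \<forall>x. dist x p < d \<longrightarrow> (\<forall>n. dist ((f ^^ n) x) p < e)"
    proof (intro exI[of _ "min d e"] conjI allI impI)
      fix x n assume x: "dist x p < min d e"
      have "r ^ n * dist x p \<le> 1 * dist x p" using r by (intro mult_right_mono power_le_one) auto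
      thus "dist ((f ^^ n) x) p < e" using iter[of x n] x by simp
    qed (use d e in simp)
  qed
  moreover have "(\<lambda>n. (f ^^ n) x) \<longlonglongrightarrow> p" if x: "dist x p < d" for x
  proof -
    have "(\<lambda>n. r ^ n * dist x p) \<longlonglongrightarrow> 0"
      using r by (intro tendsto_mult_left_zero LIMSEQ_power_zero) auto
    hence "(\<lambda>n. dist ((f ^^ n) x) p) \<longlonglongrightarrow> 0"
      by (rule Lim_null_comparison[rotated]) (use iter[OF x] in auto)
    thus ?thesis by (subst tendsto_dist_iff)
  qed
  ultimately show ?thesis unfolding locally_asymptotically_stable_def using d by blast
qed

lemma norm_step_squared:
  fixes x y :: "'v::real_inner"
  shows "(norm (x + \<alpha> *\<^sub>R y))\<^sup>2 = (norm x)\<^sup>2 + 2 * \<alpha> * (y \<bullet> x) + \<alpha>\<^sup>2 * (norm y)\<^sup>2"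
  unfolding power2_norm_eq_inner
  by (simp add: inner_add_left inner_add_right inner_commute power2_eq_square algebra_simps)

text \<open>
  By compactness of the unit sphere \<open>A x \<bullet> x \<le> - c \<parallel>x\<parallel>\<^sup>2\<close> for some \<open>c > 0\<close>. In
  \<open>\<parallel>x + \<alpha> A x\<parallel>\<^sup>2\<close> the first-order gain \<open>2 \<alpha> c\<close> then beats the second-order loss \<open>\<alpha>\<^sup>2 K\<^sup>2\<close> as soon
  as \<open>\<alpha> < c / K\<^sup>2\<close>.
\<close>

lemma small_step_contraction:
  fixes A :: "'v::euclidean_space \<Rightarrow> 'v"
  assumes lin: "linear A" and neg: "\<And>x. x \<noteq> 0 \<Longrightarrow> A x \<bullet> x < 0"
  shows "\<exists>\<alpha>\<^sub>0>0. \<forall>\<alpha>. 0 < \<alpha> \<and> \<alpha> < \<alpha>\<^sub>0 \<longrightarrow>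
           (\<exists>q. 0 \<le> q \<and> q < 1 \<and> (\<forall>x. norm (x + \<alpha> *\<^sub>R A x) \<le> q * norm x))"
proof -
  interpret A: bounded_linear A using lin by (simp add: linear_conv_bounded_linear)
  obtain K where K: "K > 0" "\<And>x. norm (A x) \<le> K * norm x"
    using A.pos_bounded by (auto simp: mult.commute)
  have "\<exists>c>0. \<forall>x. A x \<bullet> x \<le> - c * (norm x)\<^sup>2"
  proof -
    have "continuous_on (sphere 0 1) (\<lambda>x. A x \<bullet> x)"
      by (intro continuous_intros linear_continuous_on A.bounded_linear_axioms)
    moreover have "sphere (0::'v) 1 \<noteq> {}" by simp
    ultimately obtain u where u: "u \<in> sphere 0 1" "\<And>x. x \<in> sphere 0 1 \<Longrightarrow> A x \<bullet> x \<le> A u \<bullet> u"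
      using continuous_attains_sup[of "sphere 0 1" "\<lambda>x. A x \<bullet> x"] compact_sphere by blast
    from u(1) have "norm u = 1" by simp
    then have "u \<noteq> 0" by auto
    then have pos: "- (A u \<bullet> u) > 0" using neg[of u] by simp
    have "A x \<bullet> x \<le> (A u \<bullet> u) * (norm x)\<^sup>2" for x
    proof (cases "x = 0")
      case False
      have "A (x /\<^sub>R norm x) \<bullet> (x /\<^sub>R norm x) \<le> A u \<bullet> u" using False by (intro u(2)) simp
      thus ?thesis using False
        by (simp add: A.scaleR power2_eq_square field_simps)
    qed (simp add: A.zero)
    with pos show ?thesis by (intro exI[of _ "- (A u \<bullet> u)"]) auto
  qed
  then obtain c where c: "c > 0" "\<And>x. A x \<bullet> x \<le> - c * (norm x)\<^sup>2" by blast
  have "\<exists>q. 0 \<le> q \<and> q < 1 \<and> (\<forall>x. norm (x + \<alpha> *\<^sub>R A x) \<le> q * norm x)"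
    if \<alpha>: "0 < \<alpha>" "\<alpha> < c / K\<^sup>2" for \<alpha>
  proof -
    \<comment> \<open>The maximum with 0 makes \<open>sqrt s\<close> a contraction factor in \<open>[0, 1)\<close> for every \<open>\<alpha>\<close> in range.\<close>
    define s where "s = max 0 (1 - \<alpha> * c)"
    have s: "0 \<le> s" "s < 1" using \<alpha> c by (auto simp: s_def)
    have "(norm (x + \<alpha> *\<^sub>R A x))\<^sup>2 \<le> s * (norm x)\<^sup>2" for x
    proof -
      have "(norm (x + \<alpha> *\<^sub>R A x))\<^sup>2 = (norm x)\<^sup>2 + 2 * \<alpha> * (A x \<bullet> x) + \<alpha>\<^sup>2 * (norm (A x))\<^sup>2"
        by (rule norm_step_squared)
      also have "2 * \<alpha> * (A x \<bullet> x) \<le> 2 * \<alpha> * (- c * (norm x)\<^sup>2)"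
        using \<alpha> by (intro mult_left_mono c(2)) auto
      also have "\<alpha>\<^sup>2 * (norm (A x))\<^sup>2 \<le> \<alpha> * c * (norm x)\<^sup>2"
      proof -
        have "(norm (A x))\<^sup>2 \<le> (K * norm x)\<^sup>2" using K(2)[of x] by (intro power_mono) auto
        hence "\<alpha>\<^sup>2 * (norm (A x))\<^sup>2 \<le> \<alpha>\<^sup>2 * (K\<^sup>2 * (norm x)\<^sup>2)"
          by (intro mult_left_mono) (auto simp: power_mult_distrib)
        also have "\<dots> = \<alpha> * (\<alpha> * K\<^sup>2) * (norm x)\<^sup>2" by (simp add: power2_eq_square)
        also have "\<dots> \<le> \<alpha> * c * (norm x)\<^sup>2"
          using \<alpha> K(1) by (intro mult_right_mono mult_left_mono) (auto simp: field_simps)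
        finally show ?thesis .
      qed
      finally have "(norm (x + \<alpha> *\<^sub>R A x))\<^sup>2 \<le> (1 - \<alpha> * c) * (norm x)\<^sup>2" by (simp add: algebra_simps)
      also have "\<dots> \<le> s * (norm x)\<^sup>2" by (intro mult_right_mono) (auto simp: s_def)
      finally show ?thesis .
    qed
    hence "norm (x + \<alpha> *\<^sub>R A x) \<le> sqrt s * norm x" for x
      using real_sqrt_le_mono[of "(norm (x + \<alpha> *\<^sub>R A x))\<^sup>2" "s * (norm x)\<^sup>2"]
      by (simp add: real_sqrt_mult)
    thus ?thesis using s by (intro exI[of _ "sqrt s"]) simp
  qed
  thus ?thesis using c K by (intro exI[of _ "c / K\<^sup>2"]) simp
qed

text \<open>
  Both correction terms in \<open>\<parallel>v + \<alpha> A v\<parallel>\<^sup>2\<close> have the right sign, which is why instability holds for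
  all step sizes and not only for small ones.
\<close>

lemma positive_direction_expands:
  fixes A :: "'v::real_inner \<Rightarrow> 'v"
  assumes "A v \<bullet> v > 0" "\<alpha> > 0"
  shows "norm v < norm (v + \<alpha> *\<^sub>R A v)"
proof -
  have "(norm (v + \<alpha> *\<^sub>R A v))\<^sup>2 = (norm v)\<^sup>2 + 2 * \<alpha> * (A v \<bullet> v) + \<alpha>\<^sup>2 * (norm (A v))\<^sup>2"
    by (rule norm_step_squared)
  moreover have "2 * \<alpha> * (A v \<bullet> v) > 0" using assms by simp
  ultimately have "(norm v)\<^sup>2 < (norm (v + \<alpha> *\<^sub>R A v))\<^sup>2" by (smt (verit) zero_le_mult_iff zero_le_power2)
  thus ?thesis by (rule power2_less_imp_less) simp
qed

section \<open>Binary quadratic forms\<close>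

text \<open>
  Completing the square after multiplication by \<open>a\<close>.
\<close>

lemma positive_definite_binary_form:
  fixes a b x y :: real
  assumes "a > 0" "a * b > 1" "x \<noteq> 0 \<or> y \<noteq> 0"
  shows "a * x\<^sup>2 + b * y\<^sup>2 + 2 * x * y > 0"
proof -
  have "a * (a * x\<^sup>2 + b * y\<^sup>2 + 2 * x * y) = (a * x + y)\<^sup>2 + (a * b - 1) * y\<^sup>2"
    by (simp add: power2_eq_square algebra_simps)
  also have "\<dots> > 0"
  proof (cases "y = 0")
    case True
    thus ?thesis using assms by simp
  next
    case False
    thus ?thesis using assms by (intro add_nonneg_pos mult_pos_pos) auto
  qed
  finally show ?thesis using assms(1) by (simp add: zero_less_mult_iff)
qed

text \<open>
  The vector \<open>(1 + b, - (1 + a))\<close> is a witness that works uniformly, including the degenerate cases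
  \<open>a = 0\<close> and \<open>b = 0\<close>: the form takes the value \<open>(a b - 1) (a + b + 2)\<close> there.
\<close>

lemma indefinite_binary_form:
  fixes a b :: real
  assumes "a \<ge> 0" "b \<ge> 0" "a * b < 1"
  shows "a * (1 + b)\<^sup>2 + b * (- (1 + a))\<^sup>2 + 2 * (1 + b) * (- (1 + a)) < 0"
proof -
  have "a * (1 + b)\<^sup>2 + b * (- (1 + a))\<^sup>2 + 2 * (1 + b) * (- (1 + a)) = (a * b - 1) * (a + b + 2)"
    by (simp add: power2_eq_square algebra_simps)
  also have "\<dots> < 0" using assms by (intro mult_neg_pos) auto
  finally show ?thesis .
qed

section \<open>Taylor bounds and matrix estimates\<close>

lemma twice_cont_differentiable_deriv:
  assumes "twice_cont_differentiable f"
  shows "(f has_field_derivative deriv f x) (at x)"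
    and "(deriv f has_field_derivative deriv (deriv f) x) (at x)"
  using assms unfolding twice_cont_differentiable_def differentiable_on_eq_differentiable_at[OF open_UNIV]
  by (metis UNIV_I DERIV_deriv_iff_real_differentiable)+

text \<open>
  A single constant for the linear growth of \<open>f'\<close>, the quadratic growth of \<open>f\<close> and the second-order
  Taylor remainder. All three come from \<open>f'\<close> being Lipschitz; the factor \<open>1/2\<close> in Taylor's formula
  is given up, so that the mean value inequality suffices.
\<close>

lemma bounded_second_derivative_bounds:
  assumes f: "twice_cont_differentiable f"
    and bdd: "bdd_above (range (\<lambda>u. \<bar>deriv (deriv f) u\<bar>))"
  shows "\<exists>C\<ge>0. \<forall>u. \<bar>deriv f u\<bar> \<le> C * (1 + \<bar>u\<bar>) \<and> \<bar>f u\<bar> \<le> C * (1 + \<bar>u\<bar>)\<^sup>2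
           \<and> (\<forall>h. \<bar>f (u + h) - f u - deriv f u * h\<bar> \<le> C * h\<^sup>2)"
proof -
  note d = twice_cont_differentiable_deriv[OF f]
  obtain B where B: "\<And>u. \<bar>deriv (deriv f) u\<bar> \<le> B" using bdd by (auto simp: bdd_above_def)
  have B0: "B \<ge> 0" using B[of 0] by linarith
  have lip: "\<bar>deriv f x - deriv f y\<bar> \<le> B * \<bar>x - y\<bar>" for x y
    using field_differentiable_bound[of UNIV "deriv f" "deriv (deriv f)" B x y] d(2) B by simp
  have taylor: "\<bar>f (u + h) - f u - deriv f u * h\<bar> \<le> B * h\<^sup>2" for u h
  proof -
    define S where "S = {u - \<bar>h\<bar>..u + \<bar>h\<bar>}"
    define g where "g x = f x - deriv f u * x" for x
    have "norm (g (u + h) - g u) \<le> (B * \<bar>h\<bar>) * norm ((u + h) - u)"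
    proof (rule field_differentiable_bound[of S g "\<lambda>x. deriv f x - deriv f u"])
      show "(g has_field_derivative deriv f x - deriv f u) (at x within S)" for x
        unfolding g_def
        by (rule has_field_derivative_at_within) (rule derivative_eq_intros d(1) refl | simp)+
      show "norm (deriv f x - deriv f u) \<le> B * \<bar>h\<bar>" if "x \<in> S" for x
      proof -
        have "B * \<bar>x - u\<bar> \<le> B * \<bar>h\<bar>" using that B0 by (intro mult_left_mono) (auto simp: S_def)
        thus ?thesis using lip[of x u] by simp
      qed
    qed (auto simp: S_def)
    moreover have "(B * \<bar>h\<bar>) * norm ((u + h) - u) = B * h\<^sup>2"
      by (simp add: power2_eq_square abs_mult_self_eq mult.assoc)
    moreover have "g (u + h) - g u = f (u + h) - f u - deriv f u * h"
      by (simp add: g_def algebra_simps)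
    ultimately show ?thesis by (metis real_norm_def)
  qed
  define C where "C = B + \<bar>deriv f 0\<bar> + \<bar>f 0\<bar>"
  have C: "B \<le> C" "C \<ge> 0" using B0 by (auto simp: C_def)
  show ?thesis
  proof (intro exI[of _ C] conjI allI)
    fix u h :: real
    have "\<bar>deriv f u\<bar> \<le> \<bar>deriv f 0\<bar> + B * \<bar>u\<bar>" using lip[of u 0] by simp
    also have "\<dots> \<le> C * (1 + \<bar>u\<bar>)"
      using B0 by (simp add: C_def algebra_simps)
    finally show "\<bar>deriv f u\<bar> \<le> C * (1 + \<bar>u\<bar>)" .
    have "\<bar>f u\<bar> \<le> \<bar>f 0\<bar> + \<bar>deriv f 0\<bar> * \<bar>u\<bar> + B * \<bar>u\<bar>\<^sup>2"
      using taylor[of 0 u] abs_mult[of "deriv f 0" u] by simp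
    also have "\<dots> \<le> C * (1 + \<bar>u\<bar>)\<^sup>2"
    proof -
      have "C * (1 + \<bar>u\<bar>)\<^sup>2 - (\<bar>f 0\<bar> + \<bar>deriv f 0\<bar> * \<bar>u\<bar> + B * \<bar>u\<bar>\<^sup>2)
        = B + \<bar>deriv f 0\<bar> + 2 * B * \<bar>u\<bar> + \<bar>deriv f 0\<bar> * \<bar>u\<bar> + 2 * \<bar>f 0\<bar> * \<bar>u\<bar>
          + (\<bar>deriv f 0\<bar> + \<bar>f 0\<bar>) * \<bar>u\<bar>\<^sup>2"
        by (simp add: C_def power2_eq_square algebra_simps)
      moreover have "\<dots> \<ge> 0" using B0 by (intro add_nonneg_nonneg mult_nonneg_nonneg) auto
      ultimately show ?thesis by linarith
    qed
    finally show "\<bar>f u\<bar> \<le> C * (1 + \<bar>u\<bar>)\<^sup>2" .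
    have "B * h\<^sup>2 \<le> C * h\<^sup>2" using C by (intro mult_right_mono) auto
    thus "\<bar>f (u + h) - f u - deriv f u * h\<bar> \<le> C * h\<^sup>2" using taylor[of u h] by linarith
  qed (use C in auto)
qed

lemma abs_matrix_vector_component_le:
  fixes R :: "real ^ 'n ^ 'm"
  shows "\<bar>(R *v z) $ i\<bar> \<le> norm R * norm z"
proof -
  have "\<bar>(R *v z) $ i\<bar> \<le> norm (R $ i) * norm z"
    unfolding matrix_vector_mul_component by (rule Cauchy_Schwarz_ineq2)
  also have "\<dots> \<le> norm R * norm z" by (intro mult_right_mono Finite_Cartesian_Product.norm_nth_le) auto
  finally show ?thesis .
qed

lemma norm_matrix_le_sum:
  fixes R :: "real ^ 'n ^ 'm"
  shows "norm R \<le> (\<Sum>i\<in>UNIV. \<Sum>j\<in>UNIV. \<bar>R $ i $ j\<bar>)"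
proof -
  have "norm R \<le> (\<Sum>i\<in>UNIV. norm (R $ i))" unfolding norm_vec_def[of R] by (rule L2_set_le_sum) simp
  also have "\<dots> \<le> (\<Sum>i\<in>UNIV. \<Sum>j\<in>UNIV. \<bar>R $ i $ j\<bar>)" by (intro sum_mono norm_le_l1_cart)
  finally show ?thesis .
qed

text \<open>
  The form in which the derivative of the score is obtained: integrating a pointwise bound on the
  remainder gives a quadratic bound, without any interchange of limit and expectation.
\<close>

lemma has_derivative_of_quadratic_remainder:
  fixes f D :: "'v::euclidean_space \<Rightarrow> 'w::real_normed_vector"
  assumes lin: "linear D"
    and rem: "\<And>h. norm h \<le> 1 \<Longrightarrow> norm (f (x + h) - f x - D h) \<le> K * (norm h)\<^sup>2"
  shows "(f has_derivative D) (at x)"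
  unfolding has_derivative_at
proof
  show "bounded_linear D" using lin by (simp add: linear_conv_bounded_linear)
  show "(\<lambda>h. norm (f (x + h) - f x - D h) / norm h) \<midarrow>0\<rightarrow> 0"
  proof (rule Lim_null_comparison)
    show "((\<lambda>h::'v. K * norm h) \<longlongrightarrow> 0) (at 0)"
      by (intro tendsto_mult_right_zero tendsto_norm_zero tendsto_ident_at)
    have "eventually (\<lambda>h::'v. norm h < 1) (at 0)"
      using eventually_at_ball[of 1 "0::'v" UNIV] by (simp add: dist_norm)
    thus "eventually (\<lambda>h. norm (norm (f (x + h) - f x - D h) / norm h) \<le> K * norm h) (at 0)"
    proof eventually_elim
      case (elim h)
      show ?case
      proof (cases "h = 0")
        case False
        have "norm (f (x + h) - f x - D h) / norm h \<le> (K * (norm h)\<^sup>2) / norm h"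
          using rem[of h] elim by (intro divide_right_mono) auto
        also have "\<dots> = K * norm h" using False by (simp add: power2_eq_square)
        finally show ?thesis by simp
      qed simp
    qed
  qed
qed

lemma bounded_bilinear_matrix_mult:
  "bounded_bilinear ((**) :: real ^ 'n ^ 'm \<Rightarrow> real ^ 'p ^ 'n \<Rightarrow> real ^ 'p ^ 'm)"
  unfolding bilinear_conv_bounded_bilinear[symmetric] bilinear_def
  by (intro conjI allI linearI)
     (simp_all add: vec_eq_iff matrix_matrix_mult_def distrib_left distrib_right sum.distrib
        sum_distrib_left mult.assoc mult.left_commute)

lemma linear_matrixI:
  fixes A :: "real ^ 'n ^ 'm \<Rightarrow> real ^ 'p ^ 'q"
  assumes "\<And>x y i j. A (x + y) $ i $ j = A x $ i $ j + A y $ i $ j"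
    and "\<And>c x i j. A (c *\<^sub>R x) $ i $ j = c * A x $ i $ j"
  shows "linear A"
  by (rule linearI) (simp_all add: vec_eq_iff assms)

lemma integrable_vec:
  fixes F :: "'a \<Rightarrow> 'b::euclidean_space ^ 'n"
  assumes "\<And>i. integrable M (\<lambda>\<omega>. F \<omega> $ i)"
  shows "integrable M F"
proof -
  have bl: "bounded_linear (axis i :: 'b \<Rightarrow> 'b ^ 'n)" for i
    unfolding linear_conv_bounded_linear[symmetric]
    by (rule linearI) (simp_all add: axis_def vec_eq_iff)
  have "F = (\<lambda>\<omega>. \<Sum>i\<in>UNIV. axis i (F \<omega> $ i))"
    by (simp add: fun_eq_iff vec_eq_iff axis_def)
  moreover have "integrable M (\<lambda>\<omega>. \<Sum>i\<in>UNIV. axis i (F \<omega> $ i))"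
    by (intro Bochner_Integration.integrable_sum integrable_bounded_linear[OF bl] assms)
  ultimately show ?thesis by simp
qed

text \<open>
  All integrands below are compared with the same integrable function \<open>(1 + \<parallel>Z\<parallel>)\<^sup>3\<close>; this lifts
  bounds of lower degree to it.
\<close>

lemma power_bound_imp_cubic_bound:
  fixes x :: real
  assumes "\<bar>x\<bar> \<le> c * (1 + norm z) ^ n" "n \<le> 3"
  shows "\<bar>x\<bar> \<le> c * (1 + norm z) ^ 3"
proof (cases "c \<ge> 0")
  case True
  have "c * (1 + norm z) ^ n \<le> c * (1 + norm z) ^ 3"
    using assms(2) True by (intro mult_left_mono power_increasing) auto
  with assms(1) show ?thesis by linarith
next
  case False
  hence "c * (1 + norm z) ^ n < 0"
    by (intro mult_neg_pos zero_less_power add_pos_nonneg) auto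
  with assms(1) show ?thesis by linarith
qed

section \<open>Moments of the independent components\<close>

text \<open>
  Independent component analysis at a separating solution: the components of \<open>Z\<close> are the unmixed
  sources, and the \<open>\<eta>\<^sub>j\<close>, scaled by the normalisation, play the role of their score functions.
\<close>

locale ica_model = prob_space M
  for M :: "'a measure" and Z :: "'a \<Rightarrow> real ^ 'k::finite" and \<eta> :: "'k \<Rightarrow> real \<Rightarrow> real" +
  assumes Z_measurable [measurable]: "Z \<in> borel_measurable M"
    and indep: "indep_vars (\<lambda>_. borel) (\<lambda>j \<omega>. Z \<omega> $ j) UNIV"
    and centred: "\<And>j. (\<integral>\<omega>. Z \<omega> $ j \<partial>M) = 0"
    and eta_C2: "\<And>j. twice_cont_differentiable (\<eta> j)"
    and eta''_bdd: "\<And>j. bdd_above (range (\<lambda>u. \<bar>deriv (deriv (\<eta> j)) u\<bar>))"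
    and third_moment: "integrable M (\<lambda>\<omega>. norm (Z \<omega>) ^ 3)"
    and normalised: "\<And>j. (\<integral>\<omega>. \<eta> j (Z \<omega> $ j) * Z \<omega> $ j \<partial>M) = -1"
begin

lemma eta_measurable [measurable]:
  "\<eta> j \<in> borel_measurable borel" "deriv (\<eta> j) \<in> borel_measurable borel"
proof -
  note d = twice_cont_differentiable_deriv[OF eta_C2, THEN DERIV_isCont]
  show "\<eta> j \<in> borel_measurable borel" "deriv (\<eta> j) \<in> borel_measurable borel"
    by (rule borel_measurable_continuous_onI, rule continuous_at_imp_continuous_on, rule ballI, rule d)+
qed

lemma component_measurable [measurable]: "(\<lambda>\<omega>. (R *v Z \<omega>) $ j) \<in> borel_measurable M"
  unfolding matrix_vector_mul_component by measurable

lemma coordinate_measurable [measurable]: "(\<lambda>\<omega>. Z \<omega> $ j) \<in> borel_measurable M"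
  using component_measurable[of "mat 1" j] by simp

lemma integrable_cubic: "integrable M (\<lambda>\<omega>. c * (1 + norm (Z \<omega>)) ^ 3)"
proof (rule integrable_mult_right, rule Bochner_Integration.integrable_bound)
  show "integrable M (\<lambda>\<omega>. 8 + 8 * norm (Z \<omega>) ^ 3)" using third_moment by simp
  show "AE \<omega> in M. norm ((1 + norm (Z \<omega>)) ^ 3) \<le> norm (8 + 8 * norm (Z \<omega>) ^ 3)"
  proof (rule AE_I2)
    fix \<omega>
    define t where "t = norm (Z \<omega>)"
    have t: "t \<ge> 0" by (simp add: t_def)
    have "(1 + t) ^ 3 \<le> 8 + 8 * t ^ 3"
    proof (cases "t \<le> 1")
      case True
      hence "(1 + t) ^ 3 \<le> 2 ^ 3" using t by (intro power_mono) auto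
      thus ?thesis using t by (simp add: add_increasing2)
    next
      case False
      hence "(1 + t) ^ 3 \<le> (2 * t) ^ 3" using t by (intro power_mono) auto
      thus ?thesis by (simp add: power_mult_distrib)
    qed
    thus "norm ((1 + norm (Z \<omega>)) ^ 3) \<le> norm (8 + 8 * norm (Z \<omega>) ^ 3)"
      using t unfolding t_def[symmetric] by simp
  qed
qed measurable

lemma integrable_if_cubic_bound:
  assumes "X \<in> borel_measurable M" "\<And>\<omega>. \<bar>X \<omega>\<bar> \<le> c * (1 + norm (Z \<omega>)) ^ 3"
  shows "integrable M (X :: 'a \<Rightarrow> real)"
proof (rule Bochner_Integration.integrable_bound[OF integrable_cubic[of c] assms(1)], rule AE_I2)
  show "norm (X \<omega>) \<le> norm (c * (1 + norm (Z \<omega>)) ^ 3)" for \<omega>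
    unfolding real_norm_def by (rule order_trans[OF assms(2) abs_ge_self])
qed

text \<open>
  One choice of the constant in \<open>bounded_second_derivative_bounds\<close> for each component, fixed because
  it enters the integrable majorants of several integrands.
\<close>

definition eta_const where
  "eta_const j = (SOME C. C \<ge> 0 \<and> (\<forall>u. \<bar>deriv (\<eta> j) u\<bar> \<le> C * (1 + \<bar>u\<bar>) \<and> \<bar>\<eta> j u\<bar> \<le> C * (1 + \<bar>u\<bar>)\<^sup>2
           \<and> (\<forall>h. \<bar>\<eta> j (u + h) - \<eta> j u - deriv (\<eta> j) u * h\<bar> \<le> C * h\<^sup>2)))"

lemma eta_const_bounds: "eta_const j \<ge> 0" "\<bar>deriv (\<eta> j) u\<bar> \<le> eta_const j * (1 + \<bar>u\<bar>)" "\<bar>\<eta> j u\<bar> \<le> eta_const j * (1 + \<bar>u\<bar>)\<^sup>2"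
  "\<bar>\<eta> j (u + h) - \<eta> j u - deriv (\<eta> j) u * h\<bar> \<le> eta_const j * h\<^sup>2"
proof -
  have *: "eta_const j \<ge> 0 \<and> (\<forall>u. \<bar>deriv (\<eta> j) u\<bar> \<le> eta_const j * (1 + \<bar>u\<bar>) \<and> \<bar>\<eta> j u\<bar> \<le> eta_const j * (1 + \<bar>u\<bar>)\<^sup>2
           \<and> (\<forall>h. \<bar>\<eta> j (u + h) - \<eta> j u - deriv (\<eta> j) u * h\<bar> \<le> eta_const j * h\<^sup>2))"
    unfolding eta_const_def
    by (rule someI_ex[OF bounded_second_derivative_bounds[OF eta_C2[of j] eta''_bdd[of j]]])
  show "eta_const j \<ge> 0" "\<bar>deriv (\<eta> j) u\<bar> \<le> eta_const j * (1 + \<bar>u\<bar>)" "\<bar>\<eta> j u\<bar> \<le> eta_const j * (1 + \<bar>u\<bar>)\<^sup>2"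
    "\<bar>\<eta> j (u + h) - \<eta> j u - deriv (\<eta> j) u * h\<bar> \<le> eta_const j * h\<^sup>2"
    using * by blast+
qed

lemma abs_coordinate_le: "\<bar>Z \<omega> $ j\<bar> \<le> 1 + norm (Z \<omega>)"
  using component_le_norm_cart[of "Z \<omega>" j] by linarith

lemma eta_coordinate_le:
  "\<bar>deriv (\<eta> j) (Z \<omega> $ j)\<bar> \<le> eta_const j * (1 + norm (Z \<omega>))"
  "\<bar>\<eta> j (Z \<omega> $ j)\<bar> \<le> eta_const j * (1 + norm (Z \<omega>))\<^sup>2"
proof -
  have n: "1 + \<bar>Z \<omega> $ j\<bar> \<le> 1 + norm (Z \<omega>)" using component_le_norm_cart[of "Z \<omega>" j] by simp
  show "\<bar>deriv (\<eta> j) (Z \<omega> $ j)\<bar> \<le> eta_const j * (1 + norm (Z \<omega>))"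
    by (rule order_trans[OF eta_const_bounds(2) mult_left_mono[OF n eta_const_bounds(1)]])
  show "\<bar>\<eta> j (Z \<omega> $ j)\<bar> \<le> eta_const j * (1 + norm (Z \<omega>))\<^sup>2"
    by (rule order_trans[OF eta_const_bounds(3) mult_left_mono[OF power_mono[OF n] eta_const_bounds(1)]]) simp
qed

lemma integrable_moments:
  shows integrable_Z: "integrable M (\<lambda>\<omega>. Z \<omega> $ j)"
    and integrable_Z2: "integrable M (\<lambda>\<omega>. (Z \<omega> $ j)\<^sup>2)"
    and integrable_eta: "integrable M (\<lambda>\<omega>. \<eta> j (Z \<omega> $ j))"
    and integrable_eta_Z: "integrable M (\<lambda>\<omega>. \<eta> j (Z \<omega> $ j) * Z \<omega> $ l)"
    and integrable_eta': "integrable M (\<lambda>\<omega>. deriv (\<eta> j) (Z \<omega> $ j))"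
    and integrable_eta'_Z: "integrable M (\<lambda>\<omega>. deriv (\<eta> j) (Z \<omega> $ j) * Z \<omega> $ l)"
    and integrable_eta'_ZZ: "integrable M (\<lambda>\<omega>. deriv (\<eta> j) (Z \<omega> $ j) * Z \<omega> $ l * Z \<omega> $ m)"
proof -
  show "integrable M (\<lambda>\<omega>. Z \<omega> $ j)"
    by (rule integrable_if_cubic_bound[OF _ power_bound_imp_cubic_bound[where n=1 and c=1]])
       (use abs_coordinate_le in auto)
  show "integrable M (\<lambda>\<omega>. (Z \<omega> $ j)\<^sup>2)"
    by (rule integrable_if_cubic_bound[OF _ power_bound_imp_cubic_bound[where n=2 and c=1]])
       (use power_mono[OF abs_coordinate_le abs_ge_zero, of _ _ 2] in auto)
  show "integrable M (\<lambda>\<omega>. \<eta> j (Z \<omega> $ j))"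
    by (rule integrable_if_cubic_bound[OF _ power_bound_imp_cubic_bound[where n=2 and c="eta_const j"]])
       (use eta_coordinate_le in auto)
  show "integrable M (\<lambda>\<omega>. deriv (\<eta> j) (Z \<omega> $ j))"
    by (rule integrable_if_cubic_bound[OF _ power_bound_imp_cubic_bound[where n=1 and c="eta_const j"]])
       (use eta_coordinate_le in auto)
  show "integrable M (\<lambda>\<omega>. \<eta> j (Z \<omega> $ j) * Z \<omega> $ l)"
  proof (rule integrable_if_cubic_bound)
    fix \<omega>
    have "\<bar>\<eta> j (Z \<omega> $ j) * Z \<omega> $ l\<bar> \<le> (eta_const j * (1 + norm (Z \<omega>))\<^sup>2) * (1 + norm (Z \<omega>))"
      unfolding abs_mult by (intro mult_mono eta_coordinate_le abs_coordinate_le) (use eta_const_bounds in auto)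
    thus "\<bar>\<eta> j (Z \<omega> $ j) * Z \<omega> $ l\<bar> \<le> eta_const j * (1 + norm (Z \<omega>)) ^ 3"
      by (simp add: power2_eq_square power3_eq_cube)
  qed measurable
  show "integrable M (\<lambda>\<omega>. deriv (\<eta> j) (Z \<omega> $ j) * Z \<omega> $ l)"
  proof (rule integrable_if_cubic_bound[OF _ power_bound_imp_cubic_bound[where n=2]])
    fix \<omega>
    have "\<bar>deriv (\<eta> j) (Z \<omega> $ j) * Z \<omega> $ l\<bar> \<le> (eta_const j * (1 + norm (Z \<omega>))) * (1 + norm (Z \<omega>))"
      unfolding abs_mult by (intro mult_mono eta_coordinate_le abs_coordinate_le) (use eta_const_bounds in auto)
    thus "\<bar>deriv (\<eta> j) (Z \<omega> $ j) * Z \<omega> $ l\<bar> \<le> eta_const j * (1 + norm (Z \<omega>))\<^sup>2"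
      by (simp add: power2_eq_square)
  qed auto
  show "integrable M (\<lambda>\<omega>. deriv (\<eta> j) (Z \<omega> $ j) * Z \<omega> $ l * Z \<omega> $ m)"
  proof (rule integrable_if_cubic_bound)
    fix \<omega>
    have "\<bar>deriv (\<eta> j) (Z \<omega> $ j) * Z \<omega> $ l * Z \<omega> $ m\<bar>
        \<le> ((eta_const j * (1 + norm (Z \<omega>))) * (1 + norm (Z \<omega>))) * (1 + norm (Z \<omega>))"
      unfolding abs_mult by (intro mult_mono eta_coordinate_le abs_coordinate_le) (use eta_const_bounds in auto)
    thus "\<bar>deriv (\<eta> j) (Z \<omega> $ j) * Z \<omega> $ l * Z \<omega> $ m\<bar> \<le> eta_const j * (1 + norm (Z \<omega>)) ^ 3"
      by (simp add: power3_eq_cube)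
  qed measurable
qed

lemma expectation_prod:
  fixes g :: "'k \<Rightarrow> real \<Rightarrow> real"
  assumes "\<And>i. i \<in> J \<Longrightarrow> g i \<in> borel_measurable borel"
    and "\<And>i. i \<in> J \<Longrightarrow> integrable M (\<lambda>\<omega>. g i (Z \<omega> $ i))"
  shows "(\<integral>\<omega>. (\<Prod>i\<in>J. g i (Z \<omega> $ i)) \<partial>M) = (\<Prod>i\<in>J. \<integral>\<omega>. g i (Z \<omega> $ i) \<partial>M)"
  by (intro indep_vars_lebesgue_integral assms indep_vars_compose2[OF indep_vars_subset[OF indep]])
     auto

lemma expectation_mult:
  fixes f g :: "real \<Rightarrow> real"
  assumes "j \<noteq> l" "f \<in> borel_measurable borel" "g \<in> borel_measurable borel"
    and "integrable M (\<lambda>\<omega>. f (Z \<omega> $ j))" "integrable M (\<lambda>\<omega>. g (Z \<omega> $ l))"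
  shows "(\<integral>\<omega>. f (Z \<omega> $ j) * g (Z \<omega> $ l) \<partial>M) = (\<integral>\<omega>. f (Z \<omega> $ j) \<partial>M) * (\<integral>\<omega>. g (Z \<omega> $ l) \<partial>M)"
proof -
  let ?g = "\<lambda>i. if i = j then f else g"
  have "(\<integral>\<omega>. (\<Prod>i\<in>{j, l}. ?g i (Z \<omega> $ i)) \<partial>M) = (\<Prod>i\<in>{j, l}. \<integral>\<omega>. ?g i (Z \<omega> $ i) \<partial>M)"
    by (rule expectation_prod) (use assms in auto)
  thus ?thesis using assms(1) by simp
qed

lemma expectation_eta_Z:
  "(\<integral>\<omega>. \<eta> j (Z \<omega> $ j) * Z \<omega> $ m \<partial>M) = (if m = j then -1 else 0)"
proof (cases "m = j")
  case False
  have "(\<integral>\<omega>. \<eta> j (Z \<omega> $ j) * Z \<omega> $ m \<partial>M) = (\<integral>\<omega>. \<eta> j (Z \<omega> $ j) \<partial>M) * (\<integral>\<omega>. Z \<omega> $ m \<partial>M)"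
    by (rule expectation_mult) (use False in \<open>simp_all add: integrable_moments\<close>)
  thus ?thesis using False by (simp add: centred)
qed (simp add: normalised)

text \<open>
  Whenever \<open>m \<noteq> l\<close>, one of the two coordinates is independent of all other factors and centred, so
  the expectation vanishes. This is what decouples the linearisation into entries \<open>(j, l)\<close> and
  \<open>(l, j)\<close>.
\<close>

lemma expectation_eta'_ZZ:
  "(\<integral>\<omega>. deriv (\<eta> j) (Z \<omega> $ j) * Z \<omega> $ m * Z \<omega> $ l \<partial>M) =
     (if m = l then if j = l then gamma M \<eta> Z j else beta M \<eta> Z j * sigma_sq M Z l else 0)"
proof -
  consider "m = l" "j = l" | "m = l" "j \<noteq> l" | "m \<noteq> l" "j = l" | "m \<noteq> l" "j = m"
    | "m \<noteq> l" "j \<noteq> l" "j \<noteq> m" by blast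
  thus ?thesis
  proof cases
    case 1
    thus ?thesis by (simp add: gamma_def power2_eq_square mult.assoc)
  next
    case 2
    have "(\<integral>\<omega>. deriv (\<eta> j) (Z \<omega> $ j) * (Z \<omega> $ l)\<^sup>2 \<partial>M)
        = (\<integral>\<omega>. deriv (\<eta> j) (Z \<omega> $ j) \<partial>M) * (\<integral>\<omega>. (Z \<omega> $ l)\<^sup>2 \<partial>M)"
      by (rule expectation_mult) (use 2 in \<open>simp_all add: integrable_moments\<close>)
    thus ?thesis using 2 by (simp add: beta_def sigma_sq_def power2_eq_square mult.assoc)
  next
    case 3
    have "(\<integral>\<omega>. deriv (\<eta> l) (Z \<omega> $ l) * Z \<omega> $ m * Z \<omega> $ l \<partial>M)
        = (\<integral>\<omega>. (deriv (\<eta> l) (Z \<omega> $ l) * Z \<omega> $ l) * Z \<omega> $ m \<partial>M)"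
      by (simp only: mult_ac)
    also have "\<dots> = (\<integral>\<omega>. deriv (\<eta> l) (Z \<omega> $ l) * Z \<omega> $ l \<partial>M) * (\<integral>\<omega>. Z \<omega> $ m \<partial>M)"
      by (rule expectation_mult) (use 3 in \<open>simp_all add: integrable_moments\<close>)
    finally show ?thesis using 3 by (simp add: centred)
  next
    case 4
    have "(\<integral>\<omega>. (deriv (\<eta> m) (Z \<omega> $ m) * Z \<omega> $ m) * Z \<omega> $ l \<partial>M)
        = (\<integral>\<omega>. deriv (\<eta> m) (Z \<omega> $ m) * Z \<omega> $ m \<partial>M) * (\<integral>\<omega>. Z \<omega> $ l \<partial>M)"
      by (rule expectation_mult) (use 4 in \<open>simp_all add: integrable_moments\<close>)
    thus ?thesis using 4 by (simp add: centred)
  next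
    case 5
    let ?g = "\<lambda>i. if i = j then deriv (\<eta> j) else (\<lambda>x. x)"
    have "(\<integral>\<omega>. (\<Prod>i\<in>{j, m, l}. ?g i (Z \<omega> $ i)) \<partial>M) = (\<Prod>i\<in>{j, m, l}. \<integral>\<omega>. ?g i (Z \<omega> $ i) \<partial>M)"
      by (rule expectation_prod) (auto simp: integrable_moments)
    moreover have "(\<Prod>i\<in>{j, m, l}. ?g i (z $ i)) = deriv (\<eta> j) (z $ j) * z $ m * z $ l" for z
      using 5 by auto
    ultimately show ?thesis using 5 by (simp add: centred)
  qed
qed

lemma integrable_score: "integrable M (\<lambda>\<omega>. \<eta> j ((R *v Z \<omega>) $ j) * (R *v Z \<omega>) $ l)"
proof (rule integrable_if_cubic_bound)
  fix \<omega>
  define c where "c = (1 + norm R) * (1 + norm (Z \<omega>))"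
  have y: "1 + \<bar>(R *v Z \<omega>) $ i\<bar> \<le> c" for i
  proof -
    have "c = 1 + norm R + norm (Z \<omega>) + norm R * norm (Z \<omega>)" by (simp add: c_def algebra_simps)
    thus ?thesis
      using abs_matrix_vector_component_le[of R "Z \<omega>" i] norm_ge_zero[of R] norm_ge_zero[of "Z \<omega>"]
      by linarith
  qed
  have "\<bar>\<eta> j ((R *v Z \<omega>) $ j) * (R *v Z \<omega>) $ l\<bar> \<le> (eta_const j * c\<^sup>2) * c"
    unfolding abs_mult
  proof (intro mult_mono)
    show "\<bar>\<eta> j ((R *v Z \<omega>) $ j)\<bar> \<le> eta_const j * c\<^sup>2"
      by (rule order_trans[OF eta_const_bounds(3) mult_left_mono[OF power_mono[OF y] eta_const_bounds(1)]]) simp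
    show "\<bar>(R *v Z \<omega>) $ l\<bar> \<le> c" using y[of l] by simp
  qed (use eta_const_bounds in auto)
  thus "\<bar>\<eta> j ((R *v Z \<omega>) $ j) * (R *v Z \<omega>) $ l\<bar> \<le> (eta_const j * (1 + norm R) ^ 3) * (1 + norm (Z \<omega>)) ^ 3"
    by (simp add: c_def power_mult_distrib power2_eq_square power3_eq_cube mult_ac)
qed measurable

text \<open>
  The expectation is taken of a matrix-valued variable; reading off an entry commutes with it
  because the matrix as a whole is integrable.
\<close>

lemma score_matrix_component:
  "score_matrix M \<eta> Z R $ j $ l =
     (if j = l then 1 else 0) + (\<integral>\<omega>. \<eta> j ((R *v Z \<omega>) $ j) * (R *v Z \<omega>) $ l \<partial>M)"
proof -
  define F where "F \<omega> = outer_prod (apply_componentwise \<eta> (R *v Z \<omega>)) (R *v Z \<omega>)" for \<omega>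
  have comp: "F \<omega> $ i $ m = \<eta> i ((R *v Z \<omega>) $ i) * (R *v Z \<omega>) $ m" for \<omega> i m
    by (simp add: F_def outer_prod_def apply_componentwise_def)
  have int: "integrable M F"
    by (intro integrable_vec) (unfold comp, rule integrable_score)
  have "bounded_linear (\<lambda>x :: real ^ 'k ^ 'k. x $ j $ l)"
    by (rule bounded_linear_compose[OF bounded_linear_vec_nth bounded_linear_vec_nth])
  from integral_bounded_linear[OF this int]
  show ?thesis by (simp add: score_matrix_def F_def[symmetric] comp mat_def)
qed

text \<open>
  The linear map that \<open>score_matrix_has_derivative\<close> shows to be the derivative of the score at the
  identity.
\<close>

definition score_deriv :: "real ^ 'k ^ 'k \<Rightarrow> real ^ 'k ^ 'k" where
  "score_deriv \<epsilon> = (\<chi> j l. if j = l then (gamma M \<eta> Z j - 1) * \<epsilon> $ j $ j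
                           else beta M \<eta> Z j * sigma_sq M Z l * \<epsilon> $ j $ l - \<epsilon> $ l $ j)"

lemma linear_score_deriv: "linear score_deriv"
  by (rule linear_matrixI) (simp_all add: score_deriv_def algebra_simps)

lemma score_matrix_identity: "score_matrix M \<eta> Z (mat 1) = 0"
  by (simp add: vec_eq_iff score_matrix_component expectation_eta_Z)

text \<open>
  The integrand is the first-order part, in \<open>\<epsilon>\<close>, of
  \<open>\<eta>\<^sub>j ((Z + \<epsilon> Z)\<^sub>j) (Z + \<epsilon> Z)\<^sub>l\<close>. Expanding \<open>\<epsilon> Z\<close> reduces its expectation to the moments computed
  above, of which the sum over the inner index retains one each.
\<close>

lemma expectation_linear_part:
  "(\<integral>\<omega>. deriv (\<eta> j) (Z \<omega> $ j) * (\<epsilon> *v Z \<omega>) $ j * Z \<omega> $ l + \<eta> j (Z \<omega> $ j) * (\<epsilon> *v Z \<omega>) $ l \<partial>M)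
     = score_deriv \<epsilon> $ j $ l"
  and integrable_linear_part:
  "integrable M (\<lambda>\<omega>. deriv (\<eta> j) (Z \<omega> $ j) * (\<epsilon> *v Z \<omega>) $ j * Z \<omega> $ l
      + \<eta> j (Z \<omega> $ j) * (\<epsilon> *v Z \<omega>) $ l)"
proof -
  have eq: "deriv (\<eta> j) (Z \<omega> $ j) * (\<epsilon> *v Z \<omega>) $ j * Z \<omega> $ l + \<eta> j (Z \<omega> $ j) * (\<epsilon> *v Z \<omega>) $ l
    = (\<Sum>m\<in>UNIV. \<epsilon> $ j $ m * (deriv (\<eta> j) (Z \<omega> $ j) * Z \<omega> $ m * Z \<omega> $ l))
      + (\<Sum>m\<in>UNIV. \<epsilon> $ l $ m * (\<eta> j (Z \<omega> $ j) * Z \<omega> $ m))" for \<omega>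
    by (simp add: matrix_vector_mult_def sum_distrib_left sum_distrib_right mult_ac)
  have i1: "integrable M (\<lambda>\<omega>. \<Sum>m\<in>UNIV. \<epsilon> $ j $ m * (deriv (\<eta> j) (Z \<omega> $ j) * Z \<omega> $ m * Z \<omega> $ l))"
    by (intro Bochner_Integration.integrable_sum integrable_mult_right integrable_moments)
  have i2: "integrable M (\<lambda>\<omega>. \<Sum>m\<in>UNIV. \<epsilon> $ l $ m * (\<eta> j (Z \<omega> $ j) * Z \<omega> $ m))"
    by (intro Bochner_Integration.integrable_sum integrable_mult_right integrable_moments)
  show "integrable M (\<lambda>\<omega>. deriv (\<eta> j) (Z \<omega> $ j) * (\<epsilon> *v Z \<omega>) $ j * Z \<omega> $ l
      + \<eta> j (Z \<omega> $ j) * (\<epsilon> *v Z \<omega>) $ l)"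
    unfolding eq using i1 i2 by simp
  show "(\<integral>\<omega>. deriv (\<eta> j) (Z \<omega> $ j) * (\<epsilon> *v Z \<omega>) $ j * Z \<omega> $ l + \<eta> j (Z \<omega> $ j) * (\<epsilon> *v Z \<omega>) $ l \<partial>M)
     = score_deriv \<epsilon> $ j $ l"
  proof -
    have delta: "(\<Sum>m\<in>UNIV. g m * (if m = i then c else 0)) = g i * c" for g :: "'k \<Rightarrow> real" and i c
      by (simp add: if_distrib cong: if_cong)
    have "(\<integral>\<omega>. (\<Sum>m\<in>UNIV. \<epsilon> $ j $ m * (deriv (\<eta> j) (Z \<omega> $ j) * Z \<omega> $ m * Z \<omega> $ l)) \<partial>M)
        = (\<Sum>m\<in>UNIV. \<epsilon> $ j $ m * (\<integral>\<omega>. deriv (\<eta> j) (Z \<omega> $ j) * Z \<omega> $ m * Z \<omega> $ l \<partial>M))"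
      by (subst Bochner_Integration.integral_sum)
         (simp_all only: integral_mult_right_zero integrable_mult_right integrable_moments)
    also have "\<dots> = \<epsilon> $ j $ l * (if j = l then gamma M \<eta> Z j else beta M \<eta> Z j * sigma_sq M Z l)"
      unfolding expectation_eta'_ZZ by (rule delta)
    finally have s1: "(\<integral>\<omega>. (\<Sum>m\<in>UNIV. \<epsilon> $ j $ m * (deriv (\<eta> j) (Z \<omega> $ j) * Z \<omega> $ m * Z \<omega> $ l)) \<partial>M)
        = \<epsilon> $ j $ l * (if j = l then gamma M \<eta> Z j else beta M \<eta> Z j * sigma_sq M Z l)" .
    have "(\<integral>\<omega>. (\<Sum>m\<in>UNIV. \<epsilon> $ l $ m * (\<eta> j (Z \<omega> $ j) * Z \<omega> $ m)) \<partial>M)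
        = (\<Sum>m\<in>UNIV. \<epsilon> $ l $ m * (\<integral>\<omega>. \<eta> j (Z \<omega> $ j) * Z \<omega> $ m \<partial>M))"
      by (subst Bochner_Integration.integral_sum)
         (simp_all only: integral_mult_right_zero integrable_mult_right integrable_moments)
    also have "\<dots> = - \<epsilon> $ l $ j"
      unfolding expectation_eta_Z delta by simp
    finally have s2: "(\<integral>\<omega>. (\<Sum>m\<in>UNIV. \<epsilon> $ l $ m * (\<eta> j (Z \<omega> $ j) * Z \<omega> $ m)) \<partial>M) = - \<epsilon> $ l $ j" .
    show ?thesis
      unfolding eq Bochner_Integration.integral_add[OF i1 i2] s1 s2
      by (simp add: score_deriv_def algebra_simps)
  qed
qed

text \<open>
  With \<open>h = \<epsilon> Z\<close> and the Taylor remainder \<open>r\<close> of \<open>\<eta>\<^sub>j\<close>, the pointwise error of the expansion is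
  \<open>r (Z\<^sub>l + h\<^sub>l) + \<eta>\<^sub>j' h\<^sub>j h\<^sub>l\<close>. Both terms are quadratic in \<open>\<epsilon>\<close> and of degree three in \<open>\<parallel>Z\<parallel>\<close>,
  which is where the third moment is used.
\<close>

lemma score_remainder_component:
  assumes \<epsilon>: "norm \<epsilon> \<le> 1"
  shows "\<bar>(score_matrix M \<eta> Z (mat 1 + \<epsilon>) - score_matrix M \<eta> Z (mat 1) - score_deriv \<epsilon>) $ j $ l\<bar>
           \<le> (\<integral>\<omega>. 3 * eta_const j * (1 + norm (Z \<omega>)) ^ 3 \<partial>M) * (norm \<epsilon>)\<^sup>2"
proof -
  define F where "F R \<omega> = \<eta> j ((R *v Z \<omega>) $ j) * (R *v Z \<omega>) $ l" for R \<omega>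
  define G where "G \<omega> = deriv (\<eta> j) (Z \<omega> $ j) * (\<epsilon> *v Z \<omega>) $ j * Z \<omega> $ l
      + \<eta> j (Z \<omega> $ j) * (\<epsilon> *v Z \<omega>) $ l" for \<omega>
  have F: "integrable M (F R)" for R unfolding F_def by (rule integrable_score)
  have G: "integrable M G" unfolding G_def by (rule integrable_linear_part)
  have bound: "\<bar>F (mat 1 + \<epsilon>) \<omega> - F (mat 1) \<omega> - G \<omega>\<bar>
      \<le> (norm \<epsilon>)\<^sup>2 * (3 * eta_const j * (1 + norm (Z \<omega>)) ^ 3)" for \<omega>
  proof -
    define n where "n = 1 + norm (Z \<omega>)"
    define e where "e = norm \<epsilon>"
    define h where "h = \<epsilon> *v Z \<omega>"
    define z where "z = Z \<omega>"
    define r where "r = \<eta> j (z $ j + h $ j) - \<eta> j (z $ j) - deriv (\<eta> j) (z $ j) * h $ j"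
    have n: "n \<ge> 1" by (simp add: n_def)
    have e: "0 \<le> e" "e \<le> 1" using \<epsilon> by (auto simp: e_def)
    have h: "\<bar>h $ i\<bar> \<le> e * n" for i
    proof -
      have "norm \<epsilon> * norm (Z \<omega>) \<le> e * n" unfolding e_def n_def by (intro mult_left_mono) auto
      thus ?thesis using abs_matrix_vector_component_le[of \<epsilon> "Z \<omega>" i] by (simp add: h_def)
    qed
    have "e * n \<le> n" using e n by (simp add: mult_left_le_one_le)
    moreover have "\<bar>z $ l\<bar> \<le> n" unfolding z_def n_def by (rule abs_coordinate_le)
    ultimately have zh: "\<bar>z $ l + h $ l\<bar> \<le> 2 * n"
      using h[of l] abs_triangle_ineq[of "z $ l" "h $ l"] by linarith
    have r: "\<bar>r\<bar> \<le> eta_const j * (e * n)\<^sup>2"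
    proof -
      have "\<bar>r\<bar> \<le> eta_const j * (h $ j)\<^sup>2" unfolding r_def by (rule eta_const_bounds(4))
      also have "\<dots> \<le> eta_const j * (e * n)\<^sup>2"
        using power_mono[OF h[of j] abs_ge_zero, of 2] eta_const_bounds(1) by (intro mult_left_mono) auto
      finally show ?thesis .
    qed
    have d: "\<bar>deriv (\<eta> j) (z $ j)\<bar> \<le> eta_const j * n"
      unfolding z_def n_def by (rule eta_coordinate_le)
    have "F (mat 1 + \<epsilon>) \<omega> - F (mat 1) \<omega> - G \<omega>
        = r * (z $ l + h $ l) + deriv (\<eta> j) (z $ j) * h $ j * h $ l"
      by (simp add: F_def G_def matrix_vector_mult_add_rdistrib r_def h_def z_def algebra_simps)
    hence "\<bar>F (mat 1 + \<epsilon>) \<omega> - F (mat 1) \<omega> - G \<omega>\<bar>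
        \<le> \<bar>r\<bar> * \<bar>z $ l + h $ l\<bar> + \<bar>deriv (\<eta> j) (z $ j)\<bar> * \<bar>h $ j\<bar> * \<bar>h $ l\<bar>"
      using abs_triangle_ineq by (simp only: abs_mult[symmetric])
    also have "\<dots> \<le> (eta_const j * (e * n)\<^sup>2) * (2 * n) + (eta_const j * n) * (e * n) * (e * n)"
      using eta_const_bounds(1)[of j] n e by (intro add_mono mult_mono r zh h d) auto
    also have "\<dots> = e\<^sup>2 * (3 * eta_const j * n ^ 3)"
      by (simp add: power2_eq_square power3_eq_cube algebra_simps)
    finally show ?thesis by (simp add: n_def e_def)
  qed
  have "(score_matrix M \<eta> Z (mat 1 + \<epsilon>) - score_matrix M \<eta> Z (mat 1) - score_deriv \<epsilon>) $ j $ l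
      = (\<integral>\<omega>. F (mat 1 + \<epsilon>) \<omega> - F (mat 1) \<omega> - G \<omega> \<partial>M)"
  proof -
    have "(\<integral>\<omega>. F (mat 1 + \<epsilon>) \<omega> - F (mat 1) \<omega> - G \<omega> \<partial>M)
        = (\<integral>\<omega>. F (mat 1 + \<epsilon>) \<omega> \<partial>M) - (\<integral>\<omega>. F (mat 1) \<omega> \<partial>M) - (\<integral>\<omega>. G \<omega> \<partial>M)"
      using F G by simp
    moreover have "(\<integral>\<omega>. G \<omega> \<partial>M) = score_deriv \<epsilon> $ j $ l"
      unfolding G_def by (rule expectation_linear_part)
    ultimately show ?thesis by (simp add: score_matrix_component F_def)
  qed
  also have "\<bar>\<dots>\<bar> \<le> (\<integral>\<omega>. (norm \<epsilon>)\<^sup>2 * (3 * eta_const j * (1 + norm (Z \<omega>)) ^ 3) \<partial>M)"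
    by (rule order_trans[OF integral_abs_bound integral_mono])
       (use F G bound integrable_cubic in auto)
  also have "\<dots> = (\<integral>\<omega>. 3 * eta_const j * (1 + norm (Z \<omega>)) ^ 3 \<partial>M) * (norm \<epsilon>)\<^sup>2" by simp
  finally show ?thesis .
qed

lemma score_matrix_has_derivative:
  "(score_matrix M \<eta> Z has_derivative score_deriv) (at (mat 1))"
proof (rule has_derivative_of_quadratic_remainder[OF linear_score_deriv])
  fix \<epsilon> :: "real ^ 'k ^ 'k"
  assume \<epsilon>: "norm \<epsilon> \<le> 1"
  let ?K = "\<lambda>j. \<integral>\<omega>. 3 * eta_const j * (1 + norm (Z \<omega>)) ^ 3 \<partial>M"
  have "norm (score_matrix M \<eta> Z (mat 1 + \<epsilon>) - score_matrix M \<eta> Z (mat 1) - score_deriv \<epsilon>)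
      \<le> (\<Sum>j\<in>UNIV. \<Sum>l\<in>(UNIV::'k set). ?K j * (norm \<epsilon>)\<^sup>2)"
    by (rule order_trans[OF norm_matrix_le_sum]) (intro sum_mono score_remainder_component \<epsilon>)
  thus "norm (score_matrix M \<eta> Z (mat 1 + \<epsilon>) - score_matrix M \<eta> Z (mat 1) - score_deriv \<epsilon>)
      \<le> (\<Sum>j\<in>UNIV. \<Sum>l\<in>(UNIV::'k set). ?K j) * (norm \<epsilon>)\<^sup>2"
    by (simp only: sum_distrib_right)
qed

lemma update_has_derivative:
  "(update M \<eta> Z \<alpha> has_derivative (\<lambda>\<epsilon>. \<epsilon> + \<alpha> *\<^sub>R score_deriv \<epsilon>)) (at (mat 1))"
proof -
  note bounded_bilinear.FDERIV[OF bounded_bilinear_matrix_mult, derivative_intros]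
  have "(update M \<eta> Z \<alpha> has_derivative (\<lambda>\<epsilon>. (mat 1 + \<alpha> *\<^sub>R score_matrix M \<eta> Z (mat 1)) ** \<epsilon>
      + (0 + \<alpha> *\<^sub>R score_deriv \<epsilon>) ** mat 1)) (at (mat 1))"
    unfolding update_def
    by (intro derivative_intros score_matrix_has_derivative)
  thus ?thesis by (simp add: score_matrix_identity)
qed

section \<open>Sign of the quadratic form of the linearised score\<close>

lemma inner_matrix: "(x :: real ^ 'k ^ 'k) \<bullet> y = (\<Sum>j\<in>UNIV. \<Sum>l\<in>UNIV. x $ j $ l * y $ j $ l)"
  by (simp add: inner_vec_def)

text \<open>
  The diagonal part is self-adjoint entry by entry; the part \<open>\<epsilon>\<^sub>j\<^sub>l \<mapsto> - \<epsilon>\<^sub>l\<^sub>j\<close> is so because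
  transposition is.
\<close>

lemma score_deriv_selfadjoint: "score_deriv x \<bullet> y = x \<bullet> score_deriv y"
proof -
  define a where "a j l = (if j = l then gamma M \<eta> Z j - 1 else beta M \<eta> Z j * sigma_sq M Z l)" for j l
  define o' where "o' j l = (if j = l then 0 else 1 :: real)" for j l :: 'k
  have comp: "score_deriv u $ j $ l = a j l * u $ j $ l - o' j l * u $ l $ j" for u j l
    by (simp add: score_deriv_def a_def o'_def)
  have "(\<Sum>j\<in>UNIV. \<Sum>l\<in>UNIV. o' j l * x $ l $ j * y $ j $ l)
      = (\<Sum>j\<in>UNIV. \<Sum>l\<in>UNIV. o' j l * y $ l $ j * x $ j $ l)"
    by (subst sum.swap) (intro sum.cong refl, simp add: o'_def)
  thus ?thesis
    unfolding inner_matrix comp by (simp add: left_diff_distrib right_diff_distrib sum_subtractf mult_ac)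
qed

text \<open>
  Doubling the form and adding it to its transpose groups the two entries of each pair, so that
  every off-diagonal summand is the quadratic form of the matrix \<open>M\<^sub>j\<^sub>l\<close>.
\<close>

lemma score_deriv_form:
  "2 * (score_deriv \<epsilon> \<bullet> \<epsilon>) = (\<Sum>j\<in>UNIV. \<Sum>l\<in>UNIV.
     if j = l then 2 * (gamma M \<eta> Z j - 1) * (\<epsilon> $ j $ j)\<^sup>2
     else beta M \<eta> Z j * sigma_sq M Z l * (\<epsilon> $ j $ l)\<^sup>2 + beta M \<eta> Z l * sigma_sq M Z j * (\<epsilon> $ l $ j)\<^sup>2
          - 2 * \<epsilon> $ j $ l * \<epsilon> $ l $ j)"
proof -
  let ?t = "\<lambda>j l. score_deriv \<epsilon> $ j $ l * \<epsilon> $ j $ l"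
  have "2 * (score_deriv \<epsilon> \<bullet> \<epsilon>) = (\<Sum>j\<in>UNIV. \<Sum>l\<in>UNIV. ?t j l) + (\<Sum>j\<in>UNIV. \<Sum>l\<in>UNIV. ?t l j)"
    unfolding inner_matrix by (subst (2) sum.swap) simp
  also have "\<dots> = (\<Sum>j\<in>UNIV. \<Sum>l\<in>UNIV. ?t j l + ?t l j)" by (simp only: sum.distrib)
  finally show ?thesis
    by (simp only:) (intro sum.cong refl, auto simp: score_deriv_def power2_eq_square algebra_simps)
qed

lemma score_deriv_negative:
  assumes \<sigma>: "\<And>j. sigma_sq M Z j > 0"
    and \<gamma>: "\<And>j. gamma M \<eta> Z j < 1" and \<zeta>: "\<And>j. zeta M \<eta> Z j > 0"
    and \<zeta>\<zeta>: "\<And>j l. j \<noteq> l \<Longrightarrow> zeta M \<eta> Z j * zeta M \<eta> Z l > 1"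
    and "\<epsilon> \<noteq> 0"
  shows "score_deriv \<epsilon> \<bullet> \<epsilon> < 0"
proof -
  define q where "q j l = (if j = l then 2 * (gamma M \<eta> Z j - 1) * (\<epsilon> $ j $ j)\<^sup>2
     else beta M \<eta> Z j * sigma_sq M Z l * (\<epsilon> $ j $ l)\<^sup>2 + beta M \<eta> Z l * sigma_sq M Z j * (\<epsilon> $ l $ j)\<^sup>2
          - 2 * \<epsilon> $ j $ l * \<epsilon> $ l $ j)" for j l
  have neg: "q j l < 0" if "\<epsilon> $ j $ l \<noteq> 0 \<or> \<epsilon> $ l $ j \<noteq> 0" for j l
  proof (cases "j = l")
    case True
    thus ?thesis using that \<gamma>[of l] by (simp add: q_def mult_neg_pos)
  next
    case False
    have \<beta>: "beta M \<eta> Z j < 0" using \<zeta>[of j] \<sigma>[of j] by (simp add: zeta_def mult_less_0_iff)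
    have "- beta M \<eta> Z j * sigma_sq M Z l * (\<epsilon> $ j $ l)\<^sup>2 + - beta M \<eta> Z l * sigma_sq M Z j * (\<epsilon> $ l $ j)\<^sup>2
          + 2 * \<epsilon> $ j $ l * \<epsilon> $ l $ j > 0"
    proof (rule positive_definite_binary_form)
      show "- beta M \<eta> Z j * sigma_sq M Z l > 0" using \<beta> \<sigma>[of l] by (simp add: mult_neg_pos)
      show "- beta M \<eta> Z j * sigma_sq M Z l * (- beta M \<eta> Z l * sigma_sq M Z j) > 1"
        using \<zeta>\<zeta>[OF False] by (simp add: zeta_def mult_ac)
    qed (use that in auto)
    thus ?thesis using False by (simp add: q_def)
  qed
  have nonpos: "q j l \<le> 0" for j l using neg[of j l] by (cases "j = l") (force simp: q_def)+
  obtain j l where jl: "\<epsilon> $ j $ l \<noteq> 0" using \<open>\<epsilon> \<noteq> 0\<close> by (auto simp: vec_eq_iff)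
  have "0 < (\<Sum>j\<in>UNIV. \<Sum>l\<in>UNIV. - q j l)"
  proof (rule sum_pos2[of _ j])
    show "0 < (\<Sum>l\<in>UNIV. - q j l)"
      by (rule sum_pos2[of _ l]) (use neg jl nonpos in auto)
    show "0 \<le> (\<Sum>l\<in>UNIV. - q i l)" for i by (rule sum_nonneg) (use nonpos in auto)
  qed auto
  thus ?thesis using score_deriv_form[of \<epsilon>] by (simp add: q_def[symmetric] sum_negf)
qed

text \<open>
  A value \<open>\<gamma>\<^sub>j > 1\<close> is detected by the matrix unit at \<open>(j, j)\<close>. A negative \<open>\<zeta>\<^sub>j\<close> makes \<open>\<beta>\<^sub>j\<close> positive
  and is detected by the matrix unit at \<open>(j, l)\<close> for any \<open>l \<noteq> j\<close>; such an \<open>l\<close> exists as there are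
  at least two components. Otherwise \<open>\<zeta>\<^sub>j, \<zeta>\<^sub>l \<ge> 0\<close> and \<open>\<zeta>\<^sub>j \<zeta>\<^sub>l < 1\<close>, and \<open>M\<^sub>j\<^sub>l\<close> has negative
  determinant.
\<close>

lemma score_deriv_positive:
  assumes card: "CARD('k) \<ge> 2" and \<sigma>: "\<And>j. sigma_sq M Z j > 0"
    and viol: "(\<exists>j. gamma M \<eta> Z j > 1) \<or> (\<exists>j. zeta M \<eta> Z j < 0)
           \<or> (\<exists>j l. j \<noteq> l \<and> zeta M \<eta> Z j * zeta M \<eta> Z l < 1)"
  shows "\<exists>v. score_deriv v \<bullet> v > 0"
proof -
  have pair: "score_deriv v \<bullet> v
      = beta M \<eta> Z j * sigma_sq M Z l * x\<^sup>2 + beta M \<eta> Z l * sigma_sq M Z j * y\<^sup>2 - 2 * x * y"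
    if "j \<noteq> l" "v = axis j (axis l x) + axis l (axis j y)" for v j l x y
  proof -
    have v: "v $ j $ l = x" "v $ l $ j = y" using that by (simp_all add: axis_def)
    have "score_deriv v \<bullet> v = score_deriv v $ j $ l * x + score_deriv v $ l $ j * y"
      by (subst that(2)) (simp add: inner_add_right inner_axis)
    thus ?thesis using that(1) v by (simp add: score_deriv_def power2_eq_square algebra_simps)
  qed
  have neg_zeta: ?thesis if "zeta M \<eta> Z j < 0" for j
  proof -
    have "\<exists>l. l \<noteq> j"
    proof (rule ccontr)
      assume "\<not> (\<exists>l. l \<noteq> j)"
      hence "(UNIV :: 'k set) = {j}" by auto
      hence "CARD('k) = card {j}" by simp
      with card show False by simp
    qed
    then obtain l where "l \<noteq> j" by blast
    moreover have "beta M \<eta> Z j > 0"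
      using that \<sigma>[of j] by (auto simp: zeta_def zero_less_mult_iff)
    ultimately show ?thesis using pair[OF _ refl, of j l 1 0] \<sigma>[of l]
      by (intro exI[of _ "axis j (axis l 1) + axis l (axis j 0)"]) simp
  qed
  from viol consider j where "gamma M \<eta> Z j > 1" | j where "zeta M \<eta> Z j < 0"
    | j l where "j \<noteq> l" "zeta M \<eta> Z j \<ge> 0" "zeta M \<eta> Z l \<ge> 0" "zeta M \<eta> Z j * zeta M \<eta> Z l < 1"
    by (meson not_le)
  thus ?thesis
  proof cases
    case 1
    have "score_deriv (axis j (axis j 1)) \<bullet> axis j (axis j 1) = gamma M \<eta> Z j - 1"
      by (simp add: inner_axis score_deriv_def)
    with 1 show ?thesis by (intro exI[of _ "axis j (axis j 1)"]) simp
  next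
    case 2
    thus ?thesis by (rule neg_zeta)
  next
    case 3
    \<comment> \<open>The product \<open>a b\<close> equals \<open>\<zeta>\<^sub>j \<zeta>\<^sub>l\<close>: the variances only change places.\<close>
    define a b where "a = - (beta M \<eta> Z j * sigma_sq M Z l)" and "b = - (beta M \<eta> Z l * sigma_sq M Z j)"
    have "beta M \<eta> Z j \<le> 0" "beta M \<eta> Z l \<le> 0"
      using 3 \<sigma>[of j] \<sigma>[of l] by (auto simp: zeta_def mult_le_0_iff)
    hence "a \<ge> 0" "b \<ge> 0" using \<sigma>[of j] \<sigma>[of l] by (auto simp: a_def b_def mult_nonpos_nonneg)
    moreover have "a * b < 1" using 3 by (simp add: a_def b_def zeta_def mult_ac)
    ultimately show ?thesis
      using indefinite_binary_form[of a b] pair[OF 3(1) refl, of "1 + b" "- (1 + a)"]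
      by (intro exI[of _ "axis j (axis l (1 + b)) + axis l (axis j (- (1 + a)))"])
         (simp add: a_def b_def)
  qed
qed

lemma update_identity: "update M \<eta> Z \<alpha> (mat 1) = mat 1"
  by (simp add: update_def score_matrix_identity)

end

section \<open>Local stability of the identity\<close>

theorem theorem7p20:
  fixes M :: "'a measure"
    and Z :: "'a \<Rightarrow> real ^ 'k::finite"
    and \<eta> :: "'k \<Rightarrow> real \<Rightarrow> real"
  assumes "prob_space M"
    and "CARD('k) \<ge> 2"
    and "Z \<in> borel_measurable M"
    and "prob_space.indep_vars M (\<lambda>_. borel) (\<lambda>j \<omega>. Z \<omega> $ j) UNIV"
    and "\<And>j. integrable M (\<lambda>\<omega>. Z \<omega> $ j)"
    and "\<And>j. (\<integral>\<omega>. Z \<omega> $ j \<partial>M) = 0"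
    and "\<And>j. integrable M (\<lambda>\<omega>. (Z \<omega> $ j)\<^sup>2)"
    and "\<And>j. sigma_sq M Z j > 0"
    and "\<And>j. twice_cont_differentiable (\<eta> j)"
    and "\<And>j. bdd_above (range (\<lambda>u. \<bar>deriv (deriv (\<eta> j)) u\<bar>))"
    and "integrable M (\<lambda>\<omega>. norm (Z \<omega>) ^ 3)"
    and "\<And>j. (\<integral>\<omega>. \<eta> j (Z \<omega> $ j) * Z \<omega> $ j \<partial>M) = -1"
  shows
    "stationary_point M \<eta> Z (mat 1)
     \<and> (\<forall>\<alpha>>0. \<exists>L.
          ((\<lambda>\<epsilon>. update M \<eta> Z \<alpha> (mat 1 + \<epsilon>) - mat 1) has_derivative L) (at 0)
          \<and> (\<forall>\<epsilon> j. L \<epsilon> $ j $ j = (1 + \<alpha> * (gamma M \<eta> Z j - 1)) * \<epsilon> $ j $ j)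
          \<and> (\<forall>\<epsilon> j l. j \<noteq> l \<longrightarrow>
               (vector [L \<epsilon> $ j $ l, L \<epsilon> $ l $ j] :: real ^ 2) =
               (mat 1 + \<alpha> *\<^sub>R block M \<eta> Z j l) *v vector [\<epsilon> $ j $ l, \<epsilon> $ l $ j]))
     \<and> ((\<forall>j. gamma M \<eta> Z j < 1) \<and> (\<forall>j. zeta M \<eta> Z j > 0)
           \<and> (\<forall>j l. j \<noteq> l \<longrightarrow> zeta M \<eta> Z j * zeta M \<eta> Z l > 1)
         \<longrightarrow> (\<exists>\<alpha>\<^sub>0>0. \<forall>\<alpha>. 0 < \<alpha> \<and> \<alpha> < \<alpha>\<^sub>0 \<longrightarrow>
               locally_asymptotically_stable (update M \<eta> Z \<alpha>) (mat 1)))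
     \<and> ((\<exists>j. gamma M \<eta> Z j > 1) \<or> (\<exists>j. zeta M \<eta> Z j < 0)
           \<or> (\<exists>j l. j \<noteq> l \<and> zeta M \<eta> Z j * zeta M \<eta> Z l < 1)
         \<longrightarrow> (\<forall>\<alpha>>0. unstable (update M \<eta> Z \<alpha>) (mat 1)))"
proof -
  interpret ica_model M Z \<eta>
    unfolding ica_model_def ica_model_axioms_def using assms by blast
  show ?thesis
  proof (intro conjI allI impI)
    show "stationary_point M \<eta> Z (mat 1)"
      by (simp add: stationary_point_def score_matrix_identity)
  next
    fix \<alpha> :: real assume "\<alpha> > 0"
    let ?L = "\<lambda>\<epsilon>. \<epsilon> + \<alpha> *\<^sub>R score_deriv \<epsilon>"
    have "((\<lambda>\<epsilon>. update M \<eta> Z \<alpha> (mat 1 + \<epsilon>) - mat 1) has_derivative ?L) (at 0)"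
      using update_has_derivative[of \<alpha>] by (simp add: has_derivative_at update_identity)
    moreover have "?L \<epsilon> $ j $ j = (1 + \<alpha> * (gamma M \<eta> Z j - 1)) * \<epsilon> $ j $ j" for \<epsilon> j
      by (simp add: score_deriv_def algebra_simps)
    moreover have "(vector [?L \<epsilon> $ j $ l, ?L \<epsilon> $ l $ j] :: real ^ 2) =
        (mat 1 + \<alpha> *\<^sub>R block M \<eta> Z j l) *v vector [\<epsilon> $ j $ l, \<epsilon> $ l $ j]" if "j \<noteq> l" for \<epsilon> j l
      using that
      by (simp add: vec_eq_iff forall_2 matrix_vector_mult_def sum_2 block_def mat_def
          score_deriv_def algebra_simps)
    ultimately show "\<exists>L.
          ((\<lambda>\<epsilon>. update M \<eta> Z \<alpha> (mat 1 + \<epsilon>) - mat 1) has_derivative L) (at 0)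
          \<and> (\<forall>\<epsilon> j. L \<epsilon> $ j $ j = (1 + \<alpha> * (gamma M \<eta> Z j - 1)) * \<epsilon> $ j $ j)
          \<and> (\<forall>\<epsilon> j l. j \<noteq> l \<longrightarrow>
               (vector [L \<epsilon> $ j $ l, L \<epsilon> $ l $ j] :: real ^ 2) =
               (mat 1 + \<alpha> *\<^sub>R block M \<eta> Z j l) *v vector [\<epsilon> $ j $ l, \<epsilon> $ l $ j])"
      by (intro exI[of _ ?L]) blast
  next
    assume *: "(\<forall>j. gamma M \<eta> Z j < 1) \<and> (\<forall>j. zeta M \<eta> Z j > 0)
           \<and> (\<forall>j l. j \<noteq> l \<longrightarrow> zeta M \<eta> Z j * zeta M \<eta> Z l > 1)"
    have "score_deriv \<epsilon> \<bullet> \<epsilon> < 0" if "\<epsilon> \<noteq> 0" for \<epsilon>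
      by (rule score_deriv_negative) (use * assms(8) that in auto)
    from small_step_contraction[OF linear_score_deriv this]
    obtain \<alpha>\<^sub>0 where "\<alpha>\<^sub>0 > 0" and contract: "\<And>\<alpha>. 0 < \<alpha> \<Longrightarrow> \<alpha> < \<alpha>\<^sub>0 \<Longrightarrow>
        \<exists>q. 0 \<le> q \<and> q < 1 \<and> (\<forall>x. norm (x + \<alpha> *\<^sub>R score_deriv x) \<le> q * norm x)" by blast
    moreover have "locally_asymptotically_stable (update M \<eta> Z \<alpha>) (mat 1)" if "0 < \<alpha>" "\<alpha> < \<alpha>\<^sub>0" for \<alpha>
      using contract[OF that]
        stable_if_linearization_contracts[OF update_identity update_has_derivative[of \<alpha>]] by blast
    ultimately show "\<exists>\<alpha>\<^sub>0>0. \<forall>\<alpha>. 0 < \<alpha> \<and> \<alpha> < \<alpha>\<^sub>0 \<longrightarrow>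
               locally_asymptotically_stable (update M \<eta> Z \<alpha>) (mat 1)" by blast
  next
    fix \<alpha> :: real
    assume viol: "(\<exists>j. gamma M \<eta> Z j > 1) \<or> (\<exists>j. zeta M \<eta> Z j < 0)
           \<or> (\<exists>j l. j \<noteq> l \<and> zeta M \<eta> Z j * zeta M \<eta> Z l < 1)" and \<alpha>: "\<alpha> > 0"
    from score_deriv_positive[OF assms(2,8) viol] obtain v where "score_deriv v \<bullet> v > 0" ..
    then have "norm v < norm (v + \<alpha> *\<^sub>R score_deriv v)"
      using \<alpha> by (rule positive_direction_expands)
    moreover have "(x + \<alpha> *\<^sub>R score_deriv x) \<bullet> y = x \<bullet> (y + \<alpha> *\<^sub>R score_deriv y)" for x y
      by (simp add: inner_add_left inner_add_right score_deriv_selfadjoint)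
    ultimately show "unstable (update M \<eta> Z \<alpha>) (mat 1)"
      by (intro unstable_if_linearization_expands[OF update_identity update_has_derivative])
  qed
qed

end
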